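(* Suppose that there exist a weight function $w:S\to[1,\infty)$ and constants $\rho_1>0$, $b_1\ge 0$, $L>0$ such that (i) $\sum_{j\in S}w(j)q(j|i,a)\le\rho_1w(i)+b_1$ for all $(i,a)\in K$; (ii) $q^*(i)\le Lw(i)$ for all $i\in S$. Then for any $i\in S$, any $\pi\in\Pi$ and any $0\le s<t$, the following inequalities hold ($P_i^\pi$-almost surely): (a) $E_i^{\pi}[w(\xi_t)I_{\{t<T_{m+1}\}}\mid\mathcal{F}_s]\le (e^{\rho_1(t-s)}+1)w(\xi_s)+\dfrac{b_1}{\rho_1}(e^{\rho_1(t-s)}-1)$ for all $m=0,1,2,\ldots$; (b) $E_i^{\pi}[w(\xi_t)\mid\xi_s]\le (e^{\rho_1(t-s)}+1)w(\xi_s)+\dfrac{b_1}{\rho_1}(e^{\rho_1(t-s)}-1)$.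
   Context: Model. $S$ is a denumerable set (discrete topology), $A$ is a Polish space with Borel $\sigma$-algebra $\mathcal{B}(A)$, and for each $i\in S$, $A(i)\in\mathcal{B}(A)$ is the set of admissible actions in state $i$; $K:=\{(i,a): i\in S, a\in A(i)\}$. The transition rates $q(j|i,a)$ are real numbers, measurable in $a\in A(i)$ for fixed $i,j\in S$, with $q(j|i,a)\ge 0$ for $j\ne i$, $\sum_{j\in S}q(j|i,a)=0$ for all $(i,a)\in K$, and $q^*(i):=\sup_{a\in A(i)}|q(i|i,a)|<\infty$ for all $i\in S$. Path space. $S_\infty:=S\cup\{i_\infty\}$ and $A_\infty:=A\cup\{a_\infty\}$ with isolated points $i_\infty\notin S$, $a_\infty\notin A$; $A(i_\infty):=\{a_\infty\}$ and $q(\cdot|i_\infty,a_\infty):=0$. $\mathbb{R}_+:=(0,\infty)$, $\mathbb{R}_+^0:=[0,\infty)$. $\Omega$ is the union of $(S\times\mathbb{R}_+)^\infty$ (sequences $(i_0,\theta_1,i_1,\theta_2,i_2,\ldots)$) and the set of all sequences $(i_0,\theta_1,i_1,\ldots,\theta_{m-1},i_{m-1},\infty,i_\infty,\infty,i_\infty,\ldots)$ with $m\ge1$, $i_l\in S$, $\theta_l\in\mathbb{R}_+$; $\mathcal{F}$ is its Borel $\sigma$-algebra. For $\omega=(i_0,\theta_1,i_1,\ldots)$: $T_0:=0$, $X_m(\omega):=i_m$ $(m\ge 0)$, $\Theta_m(\omega):=\theta_m$, $T_m:=\theta_1+\cdots+\theta_m$ $(m\ge1)$, $T_\infty:=\lim_mT_m$,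 and $\xi_t:=X_m$ for $T_m\le t<T_{m+1}$, $\xi_t:=i_\infty$ for $t\ge T_\infty$. $\xi_{t-}:=X_m$ for $T_m<t\le T_{m+1}$ with $t<T_\infty$, $\xi_{0-}:=\xi_0$, $\xi_{t-}:=i_\infty$ for $t\ge T_\infty$. $\mathcal{F}_t:=\sigma(\{T_m\le s,X_m=j\}:j\in S,s\le t,m\ge0)$, $\mathcal{F}_{s-}:=\bigvee_{0\le t<s}\mathcal{F}_t$, and $\mathcal{P}:=\sigma(B\times\{0\}\,(B\in\mathcal{F}_0),\ B\times(s,\infty)\,(B\in\mathcal{F}_{s-},s>0))$ is the predictable $\sigma$-algebra on $\Omega\times\mathbb{R}_+^0$. $I_D$ is the indicator of $D$. Policies. $\Pi$ is the set of randomized history-dependent policies: $\mathcal{P}$-measurable transition probabilities $\pi(\cdot|\omega,t)$ on $(A_\infty,\mathcal{B}(A_\infty))$ concentrated on $A(\xi_{t-}(\omega))$. Probability. For $\pi\in\Pi$ and a probability distribution $\gamma$ on $S$, $P_\gamma^\pi$ is the unique probability measure on $(\Omega,\mathcal{F})$ with $P_\gamma^\pi(\xi_0=i)=\gamma(i)$ for all $i\in S$ and such that, under it, $\nu^\pi(\omega,dt,j):=\left[\int_A\pi(da|\omega,t)q(j|\xi_{t-}(\omega),a)I_{\{j\ne\xi_{t-}(\omega)\}}\right]dt$ is the dual predictable projection (compensator) of the random measure $\mu(\omega,dt,j):=\sum_{m\ge1}I_{\{T_m<\infty\}}I_{\{X_m=j\}}\delta_{T_m}(dt)$ on $\mathbb{R}_+\times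 S$; the stochastic basis is assumed complete. $P_i^\pi:=P_{\delta_i}^\pi$, with expectation $E_i^\pi$. Values of $w$ at $i_\infty$ are immaterial (under the stated hypotheses $i_\infty$ is reached with probability zero). *)

theory Defs
  imports "HOL-Probability.Probability"
begin

text \<open>
  \<open>q j i a\<close> is the transition rate \<open>q(j|i,a)\<close>; only its values for \<open>a \<in> Adm i\<close> matter.
\<close>

locale ctmdp =
  fixes Adm :: "'s::countable \<Rightarrow> 'a::polish_space set"
    and q :: "'s \<Rightarrow> 's \<Rightarrow> 'a \<Rightarrow> real"
  assumes Adm_borel: "\<And>i. Adm i \<in> sets borel"
    and q_measurable: "\<And>i j. q j i \<in> borel_measurable (restrict_space borel (Adm i))"
    and q_nonneg: "\<And>i j a. a \<in> Adm i \<Longrightarrow> j \<noteq> i \<Longrightarrow> 0 \<le> q j i a"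
    and q_conservative: "\<And>i a. a \<in> Adm i \<Longrightarrow> ((\<lambda>j. q j i a) has_sum 0) UNIV"
    and q_stable: "\<And>i. bdd_above ((\<lambda>a. \<bar>q i i a\<bar>) ` Adm i)"

definition qstar :: "('s \<Rightarrow> 'a set) \<Rightarrow> ('s \<Rightarrow> 's \<Rightarrow> 'a \<Rightarrow> real) \<Rightarrow> 's \<Rightarrow> real" where
  "qstar Adm q i = (SUP a\<in>Adm i. \<bar>q i i a\<bar>)"

text \<open>
  The isolated points \<open>i\<^sub>\<infinity>\<close> and \<open>a\<^sub>\<infinity>\<close> are the value \<open>None\<close> of the option types.
\<close>

definition act_algebra :: "'a::polish_space option measure" where
  "act_algebra = sigma UNIV (insert {None} ((\<lambda>B. Some ` B) ` sets borel))"

definition Adm_inf :: "('s \<Rightarrow> 'a set) \<Rightarrow> 's option \<Rightarrow> 'a option set" where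
  "Adm_inf Adm x = (case x of None \<Rightarrow> {None} | Some i \<Rightarrow> Some ` Adm i)"

definition q_inf :: "('s \<Rightarrow> 's \<Rightarrow> 'a \<Rightarrow> real) \<Rightarrow> 's \<Rightarrow> 's option \<Rightarrow> 'a option \<Rightarrow> real" where
  "q_inf q j x y = (case (x, y) of (Some i, Some a) \<Rightarrow> q j i a | _ \<Rightarrow> 0)"

text \<open>
  The sequence \<open>(i\<^sub>0, \<theta>\<^sub>1, i\<^sub>1, \<theta>\<^sub>2, \<dots>)\<close> is encoded by
  \<open>\<omega> m = (i\<^sub>m, \<theta>\<^bsub>m+1\<^esub>)\<close>.
\<close>

type_synonym 's path = "nat \<Rightarrow> 's option \<times> ennreal"

definition state :: "nat \<Rightarrow> 's path \<Rightarrow> 's option" where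
  "state m \<omega> = fst (\<omega> m)"

definition sojourn :: "nat \<Rightarrow> 's path \<Rightarrow> ennreal" where
  "sojourn m \<omega> = snd (\<omega> (m - 1))"

definition Omega :: "'s path set" where
  "Omega =
     {\<omega>. (\<forall>m. state m \<omega> \<noteq> None) \<and> (\<forall>m\<ge>1. 0 < sojourn m \<omega> \<and> sojourn m \<omega> < \<infinity>)} \<union>
     {\<omega>. \<exists>m\<ge>1. (\<forall>l<m. state l \<omega> \<noteq> None) \<and>
                (\<forall>l\<in>{1..<m}. 0 < sojourn l \<omega> \<and> sojourn l \<omega> < \<infinity>) \<and>
                (\<forall>l\<ge>m. state l \<omega> = None \<and> sojourn l \<omega> = \<infinity>)}"

text \<open>
  Both factors are second countable, so the trace of the product algebra is the Borel algebra
  of \<open>Omega\<close>.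
\<close>

definition path_algebra :: "'s::countable path measure" where
  "path_algebra =
     restrict_space (PiM UNIV (\<lambda>_. count_space UNIV \<Otimes>\<^sub>M borel)) Omega"

definition jump_time :: "nat \<Rightarrow> 's path \<Rightarrow> ennreal" where
  "jump_time m \<omega> = (\<Sum>k=1..m. sojourn k \<omega>)"

definition explosion_time :: "'s path \<Rightarrow> ennreal" where
  "explosion_time \<omega> = lim (\<lambda>m. jump_time m \<omega>)"

definition xi :: "real \<Rightarrow> 's path \<Rightarrow> 's option" where
  "xi t \<omega> =
     (if ennreal t < explosion_time \<omega>
      then state (THE m. jump_time m \<omega> \<le> ennreal t \<and> ennreal t < jump_time (Suc m) \<omega>) \<omega>
      else None)"

definition xi_left :: "real \<Rightarrow> 's path \<Rightarrow> 's option" where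
  "xi_left t \<omega> =
     (if t = 0 then xi 0 \<omega>
      else if ennreal t < explosion_time \<omega>
      then state (THE m. jump_time m \<omega> < ennreal t \<and> ennreal t \<le> jump_time (Suc m) \<omega>) \<omega>
      else None)"

definition filt :: "real \<Rightarrow> 's path measure" where
  "filt t = sigma Omega
     {{\<omega>\<in>Omega. jump_time m \<omega> \<le> ennreal s \<and> state m \<omega> = Some j} | j s m. 0 \<le> s \<and> s \<le> t}"

definition filt_left :: "real \<Rightarrow> 's path measure" where
  "filt_left s = sigma Omega (\<Union>t\<in>{0..<s}. sets (filt t))"

definition predictable :: "('s path \<times> real) measure" where
  "predictable = sigma (Omega \<times> {0..})
     ({B \<times> {0} | B. B \<in> sets (filt 0)} \<union>
      {B \<times> {s<..} | B s. 0 < s \<and> B \<in> sets (filt_left s)})"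

text \<open>
  The raw filtration \<open>filt\<close> augmented by the \<open>P\<close>-null sets: together with \<open>completion P\<close> it
  forms the complete stochastic basis.
\<close>

definition complete_filt :: "'s path measure \<Rightarrow> real \<Rightarrow> 's path measure" where
  "complete_filt P t = sigma Omega (sets (filt t) \<union> null_sets (completion P))"

definition policies :: "('s \<Rightarrow> 'a::polish_space set) \<Rightarrow> ('s path \<times> real \<Rightarrow> 'a option measure) set"
  where
  "policies Adm = {\<pi>. \<pi> \<in> predictable \<rightarrow>\<^sub>M prob_algebra act_algebra \<and>
     (\<forall>\<omega>\<in>Omega. \<forall>t\<ge>0. measure (\<pi> (\<omega>, t)) (Adm_inf Adm (xi_left t \<omega>)) = 1)}"

definition jump_measure :: "'s path \<Rightarrow> (real \<times> 's) measure" where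
  "jump_measure \<omega> =
     distr (count_space {m. 1 \<le> m \<and> jump_time m \<omega> < \<infinity>})
       (restrict_space borel {0<..} \<Otimes>\<^sub>M count_space UNIV)
       (\<lambda>m. (enn2real (jump_time m \<omega>), the (state m \<omega>)))"

text \<open>
  The integral over \<open>A\<close> is restricted to the admissible actions, where \<open>\<pi>\<close> is concentrated and
  where alone the rates are assumed to be measurable and nonnegative off the diagonal.
\<close>

definition jump_intensity ::
  "('s \<Rightarrow> 'a set) \<Rightarrow> ('s \<Rightarrow> 's \<Rightarrow> 'a \<Rightarrow> real) \<Rightarrow> ('s path \<times> real \<Rightarrow> 'a option measure) \<Rightarrow>
   's path \<Rightarrow> real \<Rightarrow> 's \<Rightarrow> ennreal" where
  "jump_intensity Adm q \<pi> \<omega> t j =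
     (\<integral>\<^sup>+ y \<in> Adm_inf Adm (xi_left t \<omega>).
        (if Some j \<noteq> xi_left t \<omega> then ennreal (q_inf q j (xi_left t \<omega>) y) else 0) \<partial>\<pi> (\<omega>, t))"

definition policy_nu ::
  "('s \<Rightarrow> 'a set) \<Rightarrow> ('s \<Rightarrow> 's \<Rightarrow> 'a \<Rightarrow> real) \<Rightarrow> ('s path \<times> real \<Rightarrow> 'a option measure) \<Rightarrow>
   's path \<Rightarrow> (real \<times> 's) measure" where
  "policy_nu Adm q \<pi> \<omega> =
     density (restrict_space lborel {0<..} \<Otimes>\<^sub>M count_space UNIV)
       (\<lambda>(t, j). jump_intensity Adm q \<pi> \<omega> t j)"

text \<open>
  \<open>\<nu>\<close> is the dual predictable projection of \<open>\<mu>\<close> under \<open>P\<close> if \<open>\<nu>\<close> is a predictable random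
  measure, i.e. \<open>\<integral>\<^bsub>(0,t]\<times>S\<^esub> W d\<nu>\<close> is a predictable process for every predictable \<open>W \<ge> 0\<close>,
  and \<open>E \<integral> W d\<mu> = E \<integral> W d\<nu>\<close> for all such \<open>W\<close>.
\<close>

definition dual_predictable_projection ::
  "'s::countable path measure \<Rightarrow> ('s path \<Rightarrow> (real \<times> 's) measure) \<Rightarrow>
   ('s path \<Rightarrow> (real \<times> 's) measure) \<Rightarrow> bool" where
  "dual_predictable_projection P \<mu> \<nu> \<longleftrightarrow>
     (\<forall>W :: ('s path \<times> real) \<times> 's \<Rightarrow> ennreal.
        W \<in> borel_measurable (predictable \<Otimes>\<^sub>M count_space UNIV) \<longrightarrow>
        (\<lambda>(\<omega>, t). \<integral>\<^sup>+ (u, j). W ((\<omega>, u), j) * indicator {0<..t} u \<partial>\<nu> \<omega>)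
          \<in> borel_measurable predictable \<and>
        (\<integral>\<^sup>+ \<omega>. (\<integral>\<^sup>+ (u, j). W ((\<omega>, u), j) \<partial>\<mu> \<omega>) \<partial>P) =
        (\<integral>\<^sup>+ \<omega>. (\<integral>\<^sup>+ (u, j). W ((\<omega>, u), j) \<partial>\<nu> \<omega>) \<partial>P))"

text \<open>
  \<open>is_policy_law Adm q \<pi> \<gamma> P\<close> states that \<open>P\<close> has the properties that characterize the
  measure \<open>P\<^sub>\<gamma>\<^sup>\<pi>\<close>.
\<close>

definition is_policy_law ::
  "('s::countable \<Rightarrow> 'a::polish_space set) \<Rightarrow> ('s \<Rightarrow> 's \<Rightarrow> 'a \<Rightarrow> real) \<Rightarrow>
   ('s path \<times> real \<Rightarrow> 'a option measure) \<Rightarrow> 's pmf \<Rightarrow> 's path measure \<Rightarrow> bool" where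
  "is_policy_law Adm q \<pi> \<gamma> P \<longleftrightarrow>
     prob_space P \<and> sets P = sets path_algebra \<and>
     (\<forall>i. measure P {\<omega>\<in>Omega. xi 0 \<omega> = Some i} = pmf \<gamma> i) \<and>
     dual_predictable_projection P jump_measure (policy_nu Adm q \<pi>)"

text \<open>
  The value \<open>c\<close> of the weight at \<open>i\<^sub>\<infinity>\<close> is left as a parameter, since it is immaterial.
\<close>

definition ext_weight :: "ennreal \<Rightarrow> ('s \<Rightarrow> real) \<Rightarrow> 's option \<Rightarrow> ennreal" where
  "ext_weight c w x = (case x of None \<Rightarrow> c | Some i \<Rightarrow> ennreal (w i))"

end

theory Submission
  imports Defs
begin

text \<open>
  With \<open>v = w + b\<^sub>1 / \<rho>\<^sub>1\<close> the drift condition becomes \<open>\<Sum>\<^sub>j v(j) q(j|i,a) \<le> \<rho>\<^sub>1 v(i)\<close>, because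
  the rates are conservative. For \<open>A \<in> F\<^sub>s\<close> let \<open>f(t)\<close> be the expectation of \<open>v(\<xi>\<^sub>t)\<close> on \<open>A\<close>,
  restricted to the paths that up to time \<open>t\<close> have made at most \<open>m\<close> jumps and visited only
  states of a set on which \<open>v\<close> is bounded. Each jump adds \<open>v\<close> of the new state and removes \<open>v\<close> of
  the old one. The compensator turns both sums into integrals, the exit rate terms are finite by
  the truncation and cancel, and \<open>f(t) \<le> f(s) + \<rho>\<^sub>1 \<integral>\<^sub>s\<^sup>t f(u) du\<close> remains. By Gronwall's
  inequality and Fatou's lemma, \<open>E[v(\<xi>\<^sub>t) | F\<^sub>s] \<le> exp(\<rho>\<^sub>1(t - s)) v(\<xi>\<^sub>s)\<close> before explosion. Since
  the exit rates are at most \<open>L v\<close>, the expected number of jumps up to time \<open>t\<close> is then finite, so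
  there is no explosion, and \<open>b\<^sub>1 / \<rho>\<^sub>1\<close> can be subtracted on both sides.
\<close>

section \<open>Jump times and states\<close>

text \<open>The obstacle is circular: neither integrability of \<open>v\<close> along the path nor
  non-explosion is known beforehand, while the drift inequality has a negative term that can be
  moved across only if it is finite. Therefore everything is kept in \<open>ennreal\<close>, gains
  and losses are carried separately, and losses are cancelled only under the truncation. The law of
  the path is accessible only through the compensator identity, and this admits only predictable
  integrands. Hence the path is cut into sojourns. The set of times from just after one jump up to
  and including the next is predictable, the left limit is constant on it, and it contains at most
  one jump. Tested there, the identity yields the gain at that jump and, read backwards, the loss.
  Localising to sets of the raw filtration at time \<open>s\<close> gives inequalities strong enough
  for both claims: events about \<open>xi s\<close> are among these sets, and completing the
  filtration changes sets only by null sets.\<close>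

lemma jump_time_0 [simp]: "jump_time 0 \<omega> = 0"
  by (simp add: jump_time_def)

lemma jump_time_Suc: "jump_time (Suc n) \<omega> = jump_time n \<omega> + sojourn (Suc n) \<omega>"
  by (simp add: jump_time_def)

lemma incseq_jump_time: "incseq (\<lambda>n. jump_time n \<omega>)"
  by (intro incseq_SucI) (simp add: jump_time_Suc)

lemma jump_time_mono: "m \<le> n \<Longrightarrow> jump_time m \<omega> \<le> jump_time n \<omega>"
  using incseq_jump_time by (auto simp: incseq_def)

lemma explosion_time_eq_SUP: "explosion_time \<omega> = (SUP n. jump_time n \<omega>)"
  unfolding explosion_time_def by (intro limI LIMSEQ_SUP incseq_jump_time)

lemma less_explosion_time_iff: "u < explosion_time \<omega> \<longleftrightarrow> (\<exists>n. u < jump_time n \<omega>)"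
  by (simp add: explosion_time_eq_SUP less_SUP_iff)

lemma sojourn_pos:
  assumes "\<omega> \<in> Omega" "1 \<le> n"
  shows "0 < sojourn n \<omega>"
proof -
  consider "0 < sojourn n \<omega>" | m where "\<forall>l\<in>{1..<m}. 0 < sojourn l \<omega>" "\<forall>l\<ge>m. sojourn l \<omega> = \<infinity>"
    using assms unfolding Omega_def by blast
  then show ?thesis
    by cases (use assms(2) in \<open>cases "n < m"; auto\<close>)+
qed

lemma jump_time_less_Suc:
  assumes "\<omega> \<in> Omega" "jump_time n \<omega> < \<infinity>"
  shows "jump_time n \<omega> < jump_time (Suc n) \<omega>"
proof -
  have "jump_time n \<omega> + 0 < jump_time n \<omega> + sojourn (Suc n) \<omega>"
    using sojourn_pos[OF assms(1), of "Suc n"] assms(2)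
    by (subst ennreal_add_left_cancel_less) auto
  then show ?thesis by (simp add: jump_time_Suc)
qed

text \<open>Only the second kind of path in \<open>Omega\<close> visits \<open>None\<close>, and its
  last genuine state has an infinite sojourn. Contrapositively, a finite jump time leads to a
  genuine state, which lets events that name a state \<open>Some j\<close> describe jump times
  alone.\<close>

lemma jump_time_infinite:
  assumes "\<omega> \<in> Omega" "state n \<omega> = None"
  shows "jump_time n \<omega> = \<infinity>"
proof -
  from assms obtain m where m: "1 \<le> m" "\<forall>l<m. state l \<omega> \<noteq> None" "\<forall>l\<ge>m. sojourn l \<omega> = \<infinity>"
    unfolding Omega_def by blast
  with assms(2) have "m \<le> n" by (meson leI)
  have "jump_time m \<omega> = \<infinity>"
    using m by (cases m) (auto simp: jump_time_Suc)
  with jump_time_mono[OF \<open>m \<le> n\<close>, of \<omega>] show ?thesis by (simp add: top_unique)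
qed

lemma jump_time_less_explosion_time:
  assumes "\<omega> \<in> Omega" "jump_time n \<omega> < \<infinity>"
  shows "jump_time n \<omega> < explosion_time \<omega>"
  using jump_time_less_Suc[OF assms] less_explosion_time_iff by blast

lemma ex_jump_interval:
  assumes "ennreal u < explosion_time \<omega>"
  obtains n where "jump_time n \<omega> \<le> ennreal u" "ennreal u < jump_time (Suc n) \<omega>"
proof -
  define N where "N = (LEAST n. ennreal u < jump_time n \<omega>)"
  have N: "ennreal u < jump_time N \<omega>"
    unfolding N_def using assms by (auto simp: less_explosion_time_iff intro: LeastI_ex)
  then obtain n where n: "N = Suc n" by (cases N) auto
  then have "\<not> ennreal u < jump_time n \<omega>"
    unfolding N_def using not_less_Least by (metis lessI)
  with N n that show thesis by force
qed

lemma ex_jump_interval_left: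
  assumes "ennreal u < explosion_time \<omega>" "0 < u"
  obtains n where "jump_time n \<omega> < ennreal u" "ennreal u \<le> jump_time (Suc n) \<omega>"
proof -
  define N where "N = (LEAST n. ennreal u \<le> jump_time n \<omega>)"
  have N: "ennreal u \<le> jump_time N \<omega>"
  proof -
    from assms(1) have "\<exists>n. ennreal u \<le> jump_time n \<omega>"
      by (auto simp: less_explosion_time_iff intro: less_imp_le)
    then show ?thesis unfolding N_def by (rule LeastI_ex)
  qed
  with assms obtain n where n: "N = Suc n" by (cases N) auto
  then have "\<not> ennreal u \<le> jump_time n \<omega>"
    unfolding N_def using not_less_Least by (metis lessI)
  with N n that show thesis by force
qed

lemma xi_eq_state:
  assumes "jump_time n \<omega> \<le> ennreal u" "ennreal u < jump_time (Suc n) \<omega>"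
  shows "xi u \<omega> = state n \<omega>"
proof -
  have "(THE m. jump_time m \<omega> \<le> ennreal u \<and> ennreal u < jump_time (Suc m) \<omega>) = n"
  proof (rule the_equality)
    fix m assume m: "jump_time m \<omega> \<le> ennreal u \<and> ennreal u < jump_time (Suc m) \<omega>"
    show "m = n"
    proof (rule ccontr)
      assume "m \<noteq> n"
      then consider "Suc m \<le> n" | "Suc n \<le> m" by linarith
      then show False
        using jump_time_mono[of "Suc m" n \<omega>] jump_time_mono[of "Suc n" m \<omega>] assms m
        by (cases) (auto dest: order_less_le_trans)
    qed
  qed (use assms in auto)
  moreover have "ennreal u < explosion_time \<omega>"
    using assms less_explosion_time_iff by blast
  ultimately show ?thesis by (simp add: xi_def)
qed

lemma xi_left_eq_state:
  assumes "\<omega> \<in> Omega" "jump_time n \<omega> < ennreal u" "ennreal u \<le> jump_time (Suc n) \<omega>"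
  shows "xi_left u \<omega> = state n \<omega>"
proof -
  have "(THE m. jump_time m \<omega> < ennreal u \<and> ennreal u \<le> jump_time (Suc m) \<omega>) = n"
  proof (rule the_equality)
    fix m assume m: "jump_time m \<omega> < ennreal u \<and> ennreal u \<le> jump_time (Suc m) \<omega>"
    show "m = n"
    proof (rule ccontr)
      assume "m \<noteq> n"
      then consider "Suc m \<le> n" | "Suc n \<le> m" by linarith
      then show False
        using jump_time_mono[of "Suc m" n \<omega>] jump_time_mono[of "Suc n" m \<omega>] assms m
        by (cases) (auto dest: order_less_le_trans)
    qed
  qed (use assms in auto)
  \<comment> \<open>The definition of \<open>xi_left\<close> tests for explosion. If the closing
    jump time is finite, explosion comes strictly later because the next sojourn is positive;
    otherwise the explosion time is infinite.\<close>
  moreover have "ennreal u < explosion_time \<omega>"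
  proof (cases "jump_time (Suc n) \<omega> < \<infinity>")
    case True
    then show ?thesis
      using jump_time_less_explosion_time[OF assms(1)] assms(3) by (metis le_less_trans)
  next
    case False
    then show ?thesis
      using less_explosion_time_iff[of "ennreal u" \<omega>]
          by (metis ennreal_less_top infinity_ennreal_def not_less_iff_gr_or_eq
          top.not_eq_extremum)
  qed
  moreover have "u \<noteq> 0" using assms(2) by auto
  ultimately show ?thesis by (simp add: xi_left_def)
qed

lemma xi_0: "\<omega> \<in> Omega \<Longrightarrow> xi 0 \<omega> = state 0 \<omega>"
  using jump_time_less_Suc[of \<omega> 0] by (intro xi_eq_state) auto

lemma xi_eq_Some_iff:
  assumes "\<omega> \<in> Omega"
  shows "xi u \<omega> = Some j \<longleftrightarrow>
    (\<exists>n. jump_time n \<omega> \<le> ennreal u \<and> ennreal u < jump_time (Suc n) \<omega> \<and> state n \<omega> = Some j)"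
proof (cases "ennreal u < explosion_time \<omega>")
  case True
  then obtain n where "jump_time n \<omega> \<le> ennreal u" "ennreal u < jump_time (Suc n) \<omega>"
    by (rule ex_jump_interval)
  then show ?thesis using xi_eq_state by metis
next
  case False
  then show ?thesis by (auto simp: xi_def less_explosion_time_iff)
qed

lemma xi_left_eq_Some_iff:
  assumes "\<omega> \<in> Omega" "0 < u"
  shows "xi_left u \<omega> = Some j \<longleftrightarrow>
    (\<exists>n. jump_time n \<omega> < ennreal u \<and> ennreal u \<le> jump_time (Suc n) \<omega> \<and> state n \<omega> = Some j)"
proof (cases "ennreal u < explosion_time \<omega>")
  case True
  then obtain n where "jump_time n \<omega> < ennreal u" "ennreal u \<le> jump_time (Suc n) \<omega>"
    using assms(2) by (rule ex_jump_interval_left)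
  then show ?thesis using xi_left_eq_state[OF assms(1)] by metis
next
  case False
  then have "xi_left u \<omega> = None" using assms by (simp add: xi_left_def)
  then show ?thesis using xi_left_eq_state[OF assms(1)] by force
qed

section \<open>Measurability\<close>

lemma space_path_algebra [simp]: "space path_algebra = Omega"
  by (simp add: path_algebra_def space_restrict_space space_PiM space_pair_measure
      PiE_UNIV_domain)

lemma measurable_coordinate:
  "(\<lambda>\<omega>. \<omega> n) \<in> path_algebra \<rightarrow>\<^sub>M count_space UNIV \<Otimes>\<^sub>M borel"
  unfolding path_algebra_def
  by (intro measurable_restrict_space1 measurable_component_singleton) simp

lemma measurable_state [measurable]: "state n \<in> path_algebra \<rightarrow>\<^sub>M count_space UNIV"
  unfolding state_def[abs_def] using measurable_coordinate by measurable

lemma measurable_sojourn [measurable]: "sojourn n \<in> borel_measurable path_algebra"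
  unfolding sojourn_def[abs_def] using measurable_coordinate by measurable

lemma measurable_jump_time [measurable]: "jump_time n \<in> borel_measurable path_algebra"
  unfolding jump_time_def[abs_def] by measurable

section \<open>The filtration of the path\<close>

lemma space_filt [simp]: "space (filt t) = Omega"
  unfolding filt_def by (rule space_measure_of) (rule subsetI, clarsimp)

lemma sets_filt: "sets (filt t) = sigma_sets Omega
    {{\<omega>\<in>Omega. jump_time m \<omega> \<le> ennreal s \<and> state m \<omega> = Some j} | j s m. 0 \<le> s \<and> s \<le> t}"
  unfolding filt_def by (intro sets_measure_of) auto

lemma sets_filt_mono: "s \<le> t \<Longrightarrow> sets (filt s) \<subseteq> sets (filt t)"
  unfolding sets_filt
  by (intro sigma_sets_mono') (clarify, intro exI conjI, rule refl, assumption, erule (1)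
      order_trans)

lemma sets_filt_subset: "sets (filt t) \<subseteq> sets path_algebra"
proof -
  have "{\<omega>\<in>Omega. jump_time m \<omega> \<le> ennreal s \<and> state m \<omega> = Some j} \<in> sets path_algebra" for j s m
    unfolding space_path_algebra[symmetric] by measurable
  then show ?thesis
    unfolding sets_filt space_path_algebra[symmetric] by (intro sets.sigma_sets_subset) auto
qed

lemma pred_filt_jump_state:
  assumes "0 \<le> t"
  shows "Measurable.pred (filt t) (\<lambda>\<omega>. jump_time n \<omega> \<le> ennreal t \<and> state n \<omega> = Some j)"
  unfolding pred_def sets_filt space_filt using assms by (intro sigma_sets.Basic) auto

text \<open>The generators of the filtration always name a state. Their countable union over
  \<open>j\<close> misses no path, since the state \<open>None\<close> forces an infinite jump
  time.\<close>

lemma pred_filt_jump: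
  assumes "0 \<le> t"
  shows "Measurable.pred (filt t) (\<lambda>\<omega> :: 's::countable path. jump_time n \<omega> \<le> ennreal t)"
proof -
  have "Measurable.pred (filt t) (\<lambda>\<omega>. \<exists>j::'s. jump_time n \<omega> \<le> ennreal t \<and> state n \<omega> = Some j)"
    by (intro pred_intros_countable pred_filt_jump_state assms)
  moreover have "jump_time n \<omega> \<le> ennreal t \<longleftrightarrow> (\<exists>j. jump_time n \<omega> \<le> ennreal t \<and> state n \<omega> = Some j)"
    if "\<omega> \<in> space (filt t)" for \<omega>
    using jump_time_infinite[of \<omega> n] that by (cases "state n \<omega>") (auto simp: top_unique)
  ultimately show ?thesis by (subst measurable_cong) auto
qed

text \<open>The truncation of the state space. Membership in the image under \<open>Some\<close>
  also rules out \<open>None\<close>, so the condition has content even for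
  \<open>D = UNIV\<close>.\<close>

definition states_in :: "'s set \<Rightarrow> nat \<Rightarrow> 's path \<Rightarrow> bool" where
  "states_in D n \<omega> \<longleftrightarrow> (\<forall>l\<le>n. state l \<omega> \<in> Some ` D)"

lemma pred_states_in [measurable]: "Measurable.pred path_algebra (states_in D n)"
  unfolding states_in_def[abs_def] by measurable

text \<open>Earlier jumps happen no later than jump \<open>n\<close>, so once that has occurred by
  time \<open>t\<close> all the states concerned have been observed by time
  \<open>t\<close>.\<close>

lemma pred_filt_states_in:
  fixes D :: "'s::countable set"
  assumes "0 \<le> t"
  shows "Measurable.pred (filt t) (\<lambda>\<omega>. jump_time n \<omega> \<le> ennreal t \<and> states_in D n \<omega>)"
proof -
  have "Measurable.pred (filt t) (\<lambda>\<omega>. jump_time n \<omega> \<le> ennreal t \<and>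
      (\<forall>l\<in>{..n}. \<exists>j\<in>D. jump_time l \<omega> \<le> ennreal t \<and> state l \<omega> = Some j))"
    by (intro pred_intros_logic pred_intros_finite pred_intros_countable_bounded
        pred_filt_jump_state pred_filt_jump assms) auto
  moreover have "(jump_time n \<omega> \<le> ennreal t \<and>
      (\<forall>l\<in>{..n}. \<exists>j\<in>D. jump_time l \<omega> \<le> ennreal t \<and> state l \<omega> = Some j)) \<longleftrightarrow>
      jump_time n \<omega> \<le> ennreal t \<and> states_in D n \<omega>" for \<omega>
    using jump_time_mono[of _ n \<omega>] by (fastforce simp: states_in_def intro: order_trans)
  ultimately show ?thesis by simp
qed

section \<open>The predictable sigma-algebra\<close>

lemma sets_filt_left: "sets (filt_left s) = sigma_sets Omega (\<Union>t\<in>{0..<s}. sets (filt t))"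
  unfolding filt_left_def
proof (rule sets_measure_of)
  show "(\<Union>t\<in>{0..<s}. sets (filt t)) \<subseteq> Pow Omega"
    by (intro UN_least) (metis sets.space_closed space_filt)
qed

lemma sets_filt_left_subset: "sets (filt_left s) \<subseteq> sets path_algebra"
  unfolding sets_filt_left space_path_algebra[symmetric]
  by (intro sets.sigma_sets_subset UN_least sets_filt_subset)

lemma sets_filt_imp_filt_left:
  assumes "B \<in> sets (filt t)" "0 \<le> t" "t < s"
  shows "B \<in> sets (filt_left s)"
  unfolding sets_filt_left using assms by (intro sigma_sets.Basic UN_I[of t]) auto

lemma predictable_generator_subset:
  "{B \<times> {0} | B :: 's::countable path set. B \<in> sets (filt 0)} \<union>
      {B \<times> {s<..} | B s. 0 < s \<and> B \<in> sets (filt_left s)} \<subseteq> Pow (Omega \<times> {0::real..})"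
proof -
  have "B \<subseteq> Omega" if "B \<in> sets (filt_left s)" for B :: "'s path set" and s
    using sets_filt_left_subset[of s] that sets.sets_into_space[of B path_algebra] by auto
  moreover have "B \<subseteq> Omega" if "B \<in> sets (filt 0)" for B :: "'s path set"
    using sets.sets_into_space[OF that] by simp
  ultimately show ?thesis
    by (auto dest!: subsetD)
qed

lemma space_predictable [simp]: "space (predictable :: ('s::countable path \<times> real) measure)
    = Omega \<times> {0..}"
  unfolding predictable_def by (rule space_measure_of[OF predictable_generator_subset])

lemma sets_predictable: "sets (predictable :: ('s::countable path \<times> real) measure) =
    sigma_sets (Omega \<times> {0..})
     ({B \<times> {0} | B. B \<in> sets (filt 0)} \<union>
      {B \<times> {s<..} | B s. 0 < s \<and> B \<in> sets (filt_left s)})"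
  unfolding predictable_def by (rule sets_measure_of[OF predictable_generator_subset])

lemma predictable_rect:
  fixes B :: "'s::countable path set"
  shows "0 \<le> t \<Longrightarrow> t < s \<Longrightarrow> B \<in> sets (filt t) \<Longrightarrow> B \<times> {s<..} \<in> sets predictable"
  unfolding sets_predictable using sets_filt_imp_filt_left[of B t s]
  by (intro sigma_sets.Basic) (auto)

lemma predictable_rect_0:
  fixes B :: "'s::countable path set"
  shows "B \<in> sets (filt 0) \<Longrightarrow> B \<times> {0} \<in> sets predictable"
  unfolding sets_predictable by (intro sigma_sets.Basic) (auto)

text \<open>The strict inequality leaves room for two rationals \<open>a < b\<close> between the
  jump time and \<open>u\<close>. The event is known at time \<open>a\<close>, hence strictly before
  \<open>b\<close>, so its product with the times after \<open>b\<close> is a generator. The lower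
  bound \<open>s \<le> a\<close> serves conditions \<open>Q\<close> that become observable only from
  time \<open>s\<close> on.\<close>

lemma pred_predictable_after_jump:
  fixes Q :: "'s::countable path \<Rightarrow> bool"
  assumes "0 \<le> s"
    and Q: "\<And>r. s \<le> r \<Longrightarrow> Measurable.pred (filt r) (\<lambda>\<omega>. jump_time n \<omega> \<le> ennreal r \<and> Q \<omega>)"
  shows "Measurable.pred predictable (\<lambda>(\<omega>, u). s < u \<and> jump_time n \<omega> < ennreal u \<and> Q \<omega>)"
proof -
  let ?I = "{(a, b). a \<in> \<rat> \<and> b \<in> \<rat> \<and> s \<le> a \<and> a < b}"
  let ?B = "\<lambda>a. {\<omega>\<in>Omega. jump_time n \<omega> \<le> ennreal a \<and> Q \<omega>}"
  have "countable (\<rat> \<times> \<rat> :: (real \<times> real) set)"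
    by (intro countable_SIGMA countable_rat)
  then have "countable ?I"
    by (rule countable_subset[rotated]) auto
  moreover have "?B a \<times> {b<..} \<in> sets predictable" if "(a, b) \<in> ?I" for a b
    using that assms(1) Q[of a] by (intro predictable_rect[of a]) (auto simp: pred_def)
  ultimately have "(\<Union>(a, b)\<in>?I. ?B a \<times> {b<..}) \<in> sets predictable"
    by (intro sets.countable_UN') auto
  moreover have "(\<Union>(a, b)\<in>?I. ?B a \<times> {b<..}) =
      {x \<in> space predictable. case x of (\<omega>, u) \<Rightarrow> s < u \<and> jump_time n \<omega> < ennreal u \<and> Q \<omega>}"
    (is "?U = ?V")
  proof (intro equalityI subsetI)
    fix x assume "x \<in> ?V"
    then obtain \<omega> u where x: "x = (\<omega>, u)" "\<omega> \<in> Omega" "0 \<le> u" "s < u" "jump_time n \<omega> < ennreal u"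
        "Q \<omega>"
      by auto
    have fin: "jump_time n \<omega> < \<top>"
      using order_less_trans[OF x(5) ennreal_less_top] .
    with x have "enn2real (jump_time n \<omega>) < u"
      by (subst enn2real_less_iff) auto
    with x have "max (enn2real (jump_time n \<omega>)) s < u" by simp
    then obtain b where b: "b \<in> \<rat>" "max (enn2real (jump_time n \<omega>)) s < b" "b < u"
      using Rats_dense_in_real by blast
    then obtain a where a: "a \<in> \<rat>" "max (enn2real (jump_time n \<omega>)) s < a" "a < b"
      using Rats_dense_in_real by blast
    from fin have "jump_time n \<omega> \<le> ennreal a"
      using a(2) by (metis ennreal_enn2real ennreal_leI less_imp_le max_less_iff_conj)
    with a b x have "(a, b) \<in> ?I" "x \<in> ?B a \<times> {b<..}"
      by auto
    then show "x \<in> ?U" by blast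
  next
    fix x assume "x \<in> ?U"
    then obtain \<omega> u a b where *: "x = (\<omega>, u)" "\<omega> \<in> Omega" "jump_time n \<omega> \<le> ennreal a" "Q \<omega>"
        "b < u" "s \<le> a" "a < b"
      by blast
    then have "ennreal a < ennreal u" using assms(1) by (intro ennreal_lessI) auto
    then have "jump_time n \<omega> < ennreal u" using *(3) by (rule le_less_trans[rotated])
    with * assms(1) show "x \<in> ?V" by simp
  qed
  ultimately show ?thesis by (simp add: pred_def)
qed

text \<open>Predictable sets are jointly measurable in path and time. This gives measurable time
  sections and access to Tonelli's theorem.\<close>

lemma measurable_predictable_id:
  "(\<lambda>x :: 's::countable path \<times> real. x) \<in> path_algebra \<Otimes>\<^sub>M restrict_space borel {0..}
      \<rightarrow>\<^sub>M predictable"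
proof -
  have 0: "{0} \<in> sets (restrict_space borel {0::real..})"
    by (auto simp: sets_restrict_space_iff)
  have "B \<times> {0} \<in> sets (path_algebra \<Otimes>\<^sub>M restrict_space borel {0::real..})" if "B \<in> sets (filt 0)"
      for B
    using that sets_filt_subset[of 0] by (intro pair_measureI 0) auto
  moreover have "B \<times> {s<..} \<in> sets (path_algebra \<Otimes>\<^sub>M restrict_space borel {0..})"
    if "B \<in> sets (filt_left s)" "0 < s" for B s
  proof -
    have "{s<..} \<in> sets (restrict_space borel {0..})"
      using that(2) by (auto simp: sets_restrict_space_iff)
    then show ?thesis
      using that(1) sets_filt_left_subset[of s] by (intro pair_measureI) auto
  qed
  ultimately have *: "y \<in> sets (path_algebra \<Otimes>\<^sub>M restrict_space borel {0..})"
    if "y \<in> {B \<times> {0} | B. B \<in> sets (filt 0)} \<union>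
      {B \<times> {s<..} | B s. 0 < s \<and> B \<in> sets (filt_left s)}" for y :: "('s path \<times> real) set"
    using that by blast
  show ?thesis
    unfolding predictable_def
  proof (rule measurable_measure_of[OF predictable_generator_subset])
    show "(\<lambda>x. x) \<in> space (path_algebra \<Otimes>\<^sub>M restrict_space borel {0::real..}) \<rightarrow> Omega \<times> {0..}"
      by (auto simp: space_pair_measure space_restrict_space)
  qed (use * in \<open>simp add: sets.Int_space_eq2\<close>)
qed

lemma measurable_Pair_predictable:
  fixes \<omega> :: "'s::countable path"
  assumes "\<omega> \<in> Omega"
  shows "(\<lambda>u. (\<omega>, u)) \<in> restrict_space borel {0..} \<rightarrow>\<^sub>M predictable"
  using measurable_compose[OF measurable_Pair1'[of \<omega> path_algebra] measurable_predictable_id]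
      assms
  by simp

lemma pred_predictable_jump_less [measurable]:
  "Measurable.pred predictable (\<lambda>(\<omega> :: 's::countable path, u). jump_time n \<omega> < ennreal u)"
proof -
  have "Measurable.pred predictable (\<lambda>(\<omega> :: 's path, u). 0 < u \<and> jump_time n \<omega> < ennreal u
      \<and> True)"
    by (intro pred_predictable_after_jump) (simp_all add: pred_filt_jump)
  then show ?thesis
    by (rule measurable_cong[THEN iffD1, rotated]) (auto simp: ennreal_eq_0_iff[symmetric]
        zero_less_iff_neq_zero order_less_le)
qed

lemma pred_predictable_jump_state:
  "Measurable.pred predictable
    (\<lambda>(\<omega> :: 's::countable path, u). 0 < u \<and> jump_time n \<omega> < ennreal u \<and> state n \<omega> = Some j)"
  by (intro pred_predictable_after_jump pred_filt_jump_state) simp_all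

lemma measurable_snd_predictable [measurable]:
  "snd \<in> borel_measurable (predictable :: ('s::countable path \<times> real) measure)"
proof (rule borel_measurableI_greater)
  fix a :: real
  \<comment> \<open>Since \<open>jump_time 0\<close> is 0, the criterion reduces to a condition on
    time alone; \<open>max 0 a\<close> supplies the nonnegative starting time it requires.\<close>
  have "Measurable.pred predictable (\<lambda>(\<omega> :: 's path, u). max 0 a < u \<and> jump_time 0 \<omega> < ennreal u
      \<and> True)"
    by (intro pred_predictable_after_jump) (simp_all add: pred_filt_jump)
  moreover have "{x \<in> space predictable. case x of (\<omega> :: 's path, u) \<Rightarrow> max 0 a < u
      \<and> jump_time 0 \<omega> < ennreal u \<and> True} =
    {x \<in> space predictable. max 0 a < snd x}"
    by (auto simp: ennreal_eq_0_iff[symmetric] zero_less_iff_neq_zero)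
  ultimately have *: "{x \<in> space predictable. max 0 a < snd (x :: 's path \<times> real)}
      \<in> sets predictable"
    by (simp add: pred_def)
  show "{x \<in> space predictable. a < snd (x :: 's path \<times> real)} \<in> sets predictable"
  proof (cases "0 \<le> a")
    case True
    with * show ?thesis by (simp add: max_def)
  next
    case False
    then have "{x \<in> space predictable. a < snd (x :: 's path \<times> real)} = space predictable" by auto
    then show ?thesis by (metis sets.top)
  qed
qed

text \<open>At positive times the left limit is \<open>j\<close> when some jump into
  \<open>j\<close> lies strictly before \<open>u\<close> and the next jump does not, a difference of
  two events of the kind treated above. Time 0 has generators of its own and is added as a separate
  slice.\<close>

lemma measurable_xi_left [measurable]:
  "(\<lambda>(\<omega>, u). xi_left u \<omega>) \<in> (predictable :: ('s::countable path \<times> real) measure)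
      \<rightarrow>\<^sub>M count_space UNIV"
proof -
  let ?P = "predictable :: ('s path \<times> real) measure"
  have "(\<lambda>(\<omega>, u). xi_left u \<omega>) -` {Some j} \<inter> space ?P \<in> sets ?P" for j
  proof -
    let ?A = "\<lambda>n. {x \<in> space ?P. case x of (\<omega>, u) \<Rightarrow> 0 < u \<and> jump_time n \<omega> < ennreal u \<and> state n \<omega>
        = Some j}"
    let ?B = "\<lambda>n. {x \<in> space ?P. case x of (\<omega>, u) \<Rightarrow> jump_time (Suc n) \<omega> < ennreal u}"
    have "{\<omega>\<in>Omega. jump_time 0 \<omega> \<le> ennreal 0 \<and> state 0 \<omega> = Some j} \<in> sets (filt 0)"
      using pred_filt_jump_state[of 0 0 j] by (simp add: pred_def)
    note predictable_rect_0[OF this]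
    moreover have "(\<Union>n. ?A n - ?B n) \<in> sets ?P"
      using pred_predictable_jump_state[of _ j] pred_predictable_jump_less
      by (intro sets.countable_UN image_subsetI sets.Diff) (simp_all add: pred_def)
    moreover have "(\<lambda>(\<omega>, u). xi_left u \<omega>) -` {Some j} \<inter> space ?P =
      {\<omega>\<in>Omega. jump_time 0 \<omega> \<le> ennreal 0 \<and> state 0 \<omega> = Some j} \<times> {0} \<union> (\<Union>n. ?A n - ?B n)"
      (is "?L = ?R")
    proof (intro set_eqI)
      fix x show "x \<in> ?L \<longleftrightarrow> x \<in> ?R"
      proof (cases "fst x \<in> Omega \<and> 0 \<le> snd x")
        case True
        then obtain \<omega> u where x: "x = (\<omega>, u)" "\<omega> \<in> Omega" "0 \<le> u" by (cases x) auto
        then consider "u = 0" | "0 < u" by linarith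
        then show ?thesis
        proof cases
          case 1
          with x show ?thesis by (simp add: xi_left_def xi_0)
        next
          case 2
          with x show ?thesis by (auto simp: xi_left_eq_Some_iff not_less)
        qed
      qed auto
    qed
    ultimately show ?thesis by (metis (no_types, lifting) sets.Un)
  qed
  note S = this
  have "(\<lambda>(\<omega>, u). xi_left u \<omega>) -` {x} \<inter> space ?P \<in> sets ?P" for x
  proof (cases x)
    case None
    have "(\<lambda>(\<omega>, u). xi_left u \<omega>) -` {x} \<inter> space ?P =
      space ?P - (\<Union>j. (\<lambda>(\<omega>, u). xi_left u \<omega>) -` {Some j} \<inter> space ?P)"
      using None by auto
    also have "\<dots> \<in> sets ?P"
      by (intro sets.Diff sets.top sets.countable_UN image_subsetI S)
    finally show ?thesis .
  qed (use S in auto)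
  then show ?thesis
    by (subst measurable_count_space_eq2_countable) (auto simp: measurable_def)
qed

section \<open>Actions and jump intensities\<close>

lemma sets_act_algebra:
  "B \<in> sets (act_algebra :: 'a::polish_space option measure) \<longleftrightarrow> Some -` B \<in> sets borel"
proof -
  let ?G = "insert {None} ((\<lambda>B. Some ` B) ` sets (borel :: 'a measure))"
  have sets: "sets (act_algebra :: 'a option measure) = sigma_sets UNIV ?G"
    unfolding act_algebra_def by (intro sets_measure_of) auto
  show ?thesis
  proof
    assume "B \<in> sets act_algebra"
    then show "Some -` B \<in> sets borel"
      unfolding sets
    proof induction
      case (Basic a)
      then show ?case by (auto simp: vimage_def inj_image_mem_iff[of Some])
    next
      case (Compl a)
      then have "- (Some -` a) \<in> sets borel" by auto
      then show ?case by (simp add: vimage_Compl Compl_eq_Diff_UNIV[symmetric])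
    next
      case (Union a)
      then show ?case by (auto simp: vimage_Union)
    qed auto
  next
    assume B: "Some -` B \<in> sets borel"
    have "B = Some ` (Some -` B) \<union> B \<inter> {None}"
      by (auto simp: image_iff)
    moreover have "Some ` (Some -` B) \<in> sigma_sets UNIV ?G"
      using B by (intro sigma_sets.Basic insertI2 imageI)
    moreover have "B \<inter> {None} \<in> sigma_sets UNIV ?G"
      by (cases "None \<in> B") (auto intro: sigma_sets.Basic sigma_sets.Empty)
    ultimately show "B \<in> sets act_algebra"
      unfolding sets by (metis sigma_sets_Un)
  qed
qed

lemma space_act_algebra [simp]: "space act_algebra = UNIV"
  by (simp add: act_algebra_def)

lemma borel_measurable_act_algebra:
  fixes f :: "'a::polish_space option \<Rightarrow> ennreal"
  assumes "(\<lambda>a. f (Some a)) \<in> borel_measurable borel"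
  shows "f \<in> borel_measurable act_algebra"
proof (rule measurableI)
  fix B :: "ennreal set" assume "B \<in> sets borel"
  with assms have "(\<lambda>a. f (Some a)) -` B \<inter> space borel \<in> sets borel" by (rule measurable_sets)
  then show "f -` B \<inter> space act_algebra \<in> sets act_algebra"
    by (simp add: sets_act_algebra vimage_comp[symmetric] comp_def) (simp add: vimage_def)
qed simp

context ctmdp begin

text \<open>The rates are measurable only on the trace over the admissible set. The indicator
  extends them by 0 to all actions, and the artificial action has rate 0.\<close>

lemma measurable_rate:
  "(\<lambda>y. (if Some j \<noteq> x then ennreal (q_inf q j x y) else 0) * indicator (Adm_inf Adm x) y)
    \<in> borel_measurable act_algebra"
proof (rule borel_measurable_act_algebra, cases x)
  case (Some i)
  have "(\<lambda>a. ennreal (q j i a) * indicator (Adm i) a) \<in> borel_measurable borel"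
    using q_measurable[of j i] Adm_borel[of i]
    by (subst borel_measurable_restrict_space_iff_ennreal[symmetric]) auto
  moreover have "indicator (Adm_inf Adm x) (Some a) = (indicator (Adm i) a :: ennreal)" for a
    using Some by (simp add: Adm_inf_def indicator_def image_iff)
  ultimately show "(\<lambda>a. (if Some j \<noteq> x then ennreal (q_inf q j x (Some a)) else 0) *
      indicator (Adm_inf Adm x) (Some a)) \<in> borel_measurable borel"
    unfolding Some by (cases "j = i") (simp_all add: q_inf_def)
qed (simp add: q_inf_def)

text \<open>The left limit takes countably many values, so it may be frozen. For a fixed state the
  integrand depends on the action alone, and integrating it against a measurable kernel is a
  measurable operation.\<close>

lemma measurable_jump_intensity:
  assumes "\<pi> \<in> policies Adm"
  shows "(\<lambda>((\<omega>, u), j). jump_intensity Adm q \<pi> \<omega> u j)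
    \<in> borel_measurable (predictable \<Otimes>\<^sub>M count_space UNIV)"
proof -
  have \<pi>: "\<pi> \<in> predictable \<rightarrow>\<^sub>M subprob_algebra act_algebra"
    using assms by (auto simp: policies_def intro: measurable_prob_algebraD)
  have "(\<lambda>z. (\<lambda>x z. integral\<^sup>N (\<pi> z) (\<lambda>y. (if Some j \<noteq> x then ennreal (q_inf q j x y) else 0) *
      indicator (Adm_inf Adm x) y)) ((\<lambda>(\<omega>, u). xi_left u \<omega>) z) z) \<in> borel_measurable predictable"
          for j
    by (rule measurable_compose_countable'[OF _ measurable_xi_left countableI_type])
      (rule measurable_compose[OF \<pi> nn_integral_measurable_subprob_algebra[OF measurable_rate]])
  then have "(\<lambda>(\<omega>, u). jump_intensity Adm q \<pi> \<omega> u j) \<in> borel_measurable predictable" for j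
    unfolding jump_intensity_def split_beta prod.collapse .
  note * = this
  have "(\<lambda>x. (\<lambda>j (\<omega>, u). jump_intensity Adm q \<pi> \<omega> u j) (snd x) (fst x))
      \<in> borel_measurable (predictable \<Otimes>\<^sub>M count_space UNIV)"
    by (rule measurable_compose_countable'[OF _ measurable_snd countableI_type])
      (rule measurable_compose[OF measurable_fst *])
  then show ?thesis unfolding split_beta .
qed

end

section \<open>Total intensities under a law of the policy\<close>

locale ctmdp_law = ctmdp Adm q
  for Adm :: "'s::countable \<Rightarrow> 'a::polish_space set" and q :: "'s \<Rightarrow> 's \<Rightarrow> 'a \<Rightarrow> real" +
  fixes \<pi> :: "'s path \<times> real \<Rightarrow> 'a option measure" and P :: "'s path measure"
  assumes policy: "\<pi> \<in> policies Adm"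
    and prob_space_P: "prob_space P"
    and sets_P [measurable_cong]: "sets P = sets path_algebra"
    and projection: "dual_predictable_projection P jump_measure (policy_nu Adm q \<pi>)"
begin

sublocale prob_space P by (rule prob_space_P)

lemma space_P [simp]: "space P = Omega"
  using sets_P by (metis sets_eq_imp_space_eq space_path_algebra)

text \<open>The generator applied to \<open>g\<close> without its diagonal term: for
  \<open>g = v\<close> the rate of gain in the drift inequality, for \<open>g = 1\<close> the total
  rate of leaving \<open>x\<close>.\<close>

definition exit_rate :: "('s \<Rightarrow> ennreal) \<Rightarrow> 's \<Rightarrow> 'a option \<Rightarrow> ennreal" where
  "exit_rate g x y = (\<integral>\<^sup>+ j. g j * (if j \<noteq> x then ennreal (q_inf q j (Some x) y) else 0)
      \<partial>count_space UNIV)"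

text \<open>The predictable intensity of the process that adds \<open>g\<close> of the new state at
  every jump.\<close>

definition intensity :: "('s \<Rightarrow> ennreal) \<Rightarrow> 's path \<Rightarrow> real \<Rightarrow> ennreal" where
  "intensity g \<omega> u = (\<integral>\<^sup>+ j. g j * jump_intensity Adm q \<pi> \<omega> u j \<partial>count_space UNIV)"

lemma measurable_exit_rate:
  "(\<lambda>y. exit_rate g x y * indicator (Adm_inf Adm (Some x)) y) \<in> borel_measurable act_algebra"
proof -
  have 1: "(\<lambda>y. g j * ((if Some j \<noteq> Some x then ennreal (q_inf q j (Some x) y) else 0)
      * indicator (Adm_inf Adm (Some x)) y)) \<in> borel_measurable act_algebra" for j
    by (rule borel_measurable_times_ennreal[OF borel_measurable_const measurable_rate])
  have "(\<lambda>z. (\<lambda>j y. g j * ((if Some j \<noteq> Some x then ennreal (q_inf q j (Some x) y) else 0)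
      * indicator (Adm_inf Adm (Some x)) y)) (snd z) (fst z))
          \<in> borel_measurable (act_algebra \<Otimes>\<^sub>M count_space UNIV)"
    by (rule measurable_compose_countable'[OF _ measurable_snd countableI_type])
      (rule measurable_compose[OF measurable_fst 1])
  then have "(\<lambda>y. \<integral>\<^sup>+ j. g j * ((if Some j \<noteq> Some x then ennreal (q_inf q j (Some x) y) else 0)
      * indicator (Adm_inf Adm (Some x)) y) \<partial>count_space UNIV) \<in> borel_measurable act_algebra"
    by (intro sigma_finite_measure.borel_measurable_nn_integral[OF
        sigma_finite_measure_count_space])
      (simp add: split_beta')
  then show ?thesis
    by (simp add: exit_rate_def nn_integral_multc[symmetric] mult.assoc)
qed

lemma policy_kernel:
  assumes "\<omega> \<in> Omega" "0 \<le> u"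
  shows "prob_space (\<pi> (\<omega>, u))" "sets (\<pi> (\<omega>, u)) = sets act_algebra"
proof -
  have "\<pi> (\<omega>, u) \<in> space (prob_algebra act_algebra)"
    using policy assms by (auto simp: policies_def dest!: measurable_space)
  then show "prob_space (\<pi> (\<omega>, u))" "sets (\<pi> (\<omega>, u)) = sets act_algebra"
    by (auto simp: space_prob_algebra)
qed

lemma intensity_eq:
  assumes "\<omega> \<in> Omega" "0 \<le> u" "xi_left u \<omega> = Some x"
  shows "intensity g \<omega> u = (\<integral>\<^sup>+ y. exit_rate g x y * indicator (Adm_inf Adm (Some x)) y
      \<partial>\<pi> (\<omega>, u))"
proof -
  let ?f = "\<lambda>j y. (if Some j \<noteq> Some x then ennreal (q_inf q j (Some x) y) else 0)
      * indicator (Adm_inf Adm (Some x)) y"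
  have m: "?f j \<in> borel_measurable (\<pi> (\<omega>, u))" for j
    using measurable_rate[of j "Some x"] policy_kernel(2)[OF assms(1,2)]
        by (simp cong: measurable_cong_sets)
  have "intensity g \<omega> u = (\<integral>\<^sup>+ j. (\<integral>\<^sup>+ y. g j * ?f j y \<partial>\<pi> (\<omega>, u)) \<partial>count_space UNIV)"
    unfolding intensity_def jump_intensity_def assms(3) using m by (simp add: nn_integral_cmult)
  also have "\<dots> = (\<integral>\<^sup>+ y. (\<integral>\<^sup>+ j. g j * ?f j y \<partial>count_space UNIV) \<partial>\<pi> (\<omega>, u))"
    by (rule nn_integral_count_space_nn_integral[symmetric])
      (use m in \<open>auto intro: borel_measurable_times_ennreal\<close>)
  also have "\<dots> = (\<integral>\<^sup>+ y. exit_rate g x y * indicator (Adm_inf Adm (Some x)) y \<partial>\<pi> (\<omega>, u))"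
    by (simp add: exit_rate_def nn_integral_multc[symmetric] mult.assoc)
  finally show ?thesis .
qed

text \<open>The inequality between rates is averaged over the policy's distribution on actions.
  Total mass 1 preserves the constant \<open>c\<close>, and outside the admissible actions the left
  integrand vanishes. The drift condition enters with \<open>d = v x\<close> and
  \<open>h = 1\<close>, the exit rate bound with \<open>d = 0\<close>.\<close>

lemma intensity_le:
  assumes "\<omega> \<in> Omega" "0 \<le> u" "xi_left u \<omega> = Some x"
    and le: "\<And>a. a \<in> Adm x \<Longrightarrow> exit_rate g x (Some a) \<le> c + d * exit_rate h x (Some a)"
  shows "intensity g \<omega> u \<le> c + d * intensity h \<omega> u"
proof -
  note emeasure_1 = prob_space.emeasure_space_1[OF policy_kernel(1)[OF assms(1,2)]]
  let ?I = "\<lambda>y. indicator (Adm_inf Adm (Some x)) y :: ennreal"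
  have m: "(\<lambda>y. exit_rate h x y * ?I y) \<in> borel_measurable (\<pi> (\<omega>, u))"
    using measurable_exit_rate policy_kernel(2)[OF assms(1,2)]
        by (simp cong: measurable_cong_sets)
  have "intensity g \<omega> u = (\<integral>\<^sup>+ y. exit_rate g x y * ?I y \<partial>\<pi> (\<omega>, u))"
    by (rule intensity_eq[OF assms(1-3)])
  also have "\<dots> \<le> (\<integral>\<^sup>+ y. c + d * (exit_rate h x y * ?I y) \<partial>\<pi> (\<omega>, u))"
    by (intro nn_integral_mono) (auto simp: Adm_inf_def indicator_def le)
  also have "\<dots> = c + d * intensity h \<omega> u"
    using m by (simp add: nn_integral_add nn_integral_cmult intensity_eq[OF assms(1-3)]
        emeasure_1)
  finally show ?thesis .
qed

lemma measurable_intensity: "(\<lambda>(\<omega>, u). intensity g \<omega> u) \<in> borel_measurable predictable"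
proof -
  have "(\<lambda>z. g (snd z) * jump_intensity Adm q \<pi> (fst (fst z)) (snd (fst z)) (snd z))
    \<in> borel_measurable (predictable \<Otimes>\<^sub>M count_space UNIV)"
  proof (rule borel_measurable_times_ennreal)
    show "(\<lambda>z. jump_intensity Adm q \<pi> (fst (fst z)) (snd (fst z)) (snd z))
        \<in> borel_measurable (predictable \<Otimes>\<^sub>M count_space UNIV)"
      using measurable_jump_intensity[OF policy] by (simp add: split_beta')
    show "(\<lambda>z. g (snd z)) \<in> borel_measurable (predictable \<Otimes>\<^sub>M count_space UNIV)"
      by (rule measurable_compose[OF measurable_snd]) simp
  qed
  then have "(\<lambda>x. \<integral>\<^sup>+ j. g j * jump_intensity Adm q \<pi> (fst x) (snd x) j \<partial>count_space UNIV)
      \<in> borel_measurable predictable"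
    by (intro sigma_finite_measure.borel_measurable_nn_integral[OF
        sigma_finite_measure_count_space])
      (simp add: split_beta')
  then show ?thesis by (simp add: intensity_def split_beta')
qed

lemma measurable_pos_half_line:
  "(\<lambda>u. u) \<in> restrict_space lborel {0<..} \<rightarrow>\<^sub>M restrict_space borel {0::real..}"
  by (rule measurable_restrict_space3) auto

lemma predictable_section:
  fixes f :: "'s path \<times> real \<Rightarrow> ennreal"
  assumes "f \<in> borel_measurable predictable" "\<omega> \<in> Omega"
  shows "(\<lambda>u. f (\<omega>, u)) \<in> borel_measurable (restrict_space lborel {0<..})"
proof -
  have "(\<lambda>u. f (\<omega>, u)) \<in> borel_measurable (restrict_space borel {0..})"
    by (rule measurable_compose[OF measurable_Pair_predictable assms(1)]) fact
  with measurable_pos_half_line show ?thesis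
    by (rule measurable_compose)
qed

lemma measurable_predictable_integral:
  fixes f :: "'s path \<times> real \<Rightarrow> ennreal"
  assumes "f \<in> borel_measurable predictable"
  shows "(\<lambda>\<omega>. \<integral>\<^sup>+ u. f (\<omega>, u) \<partial>restrict_space lborel {0<..}) \<in> borel_measurable P"
proof -
  have 1: "f \<in> borel_measurable (path_algebra \<Otimes>\<^sub>M restrict_space borel {0..})"
    using measurable_compose[OF measurable_predictable_id assms] by simp
  have "(\<lambda>z. (fst z, snd z)) \<in> P \<Otimes>\<^sub>M restrict_space lborel {0::real<..}
      \<rightarrow>\<^sub>M path_algebra \<Otimes>\<^sub>M restrict_space borel {0..}"
  proof (rule measurable_Pair)
    show "fst \<in> P \<Otimes>\<^sub>M restrict_space lborel {0::real<..} \<rightarrow>\<^sub>M path_algebra"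
      using sets_P by (simp cong: measurable_cong_sets)
    show "snd \<in> P \<Otimes>\<^sub>M restrict_space lborel {0::real<..} \<rightarrow>\<^sub>M restrict_space borel {0..}"
      by (rule measurable_compose[OF measurable_snd measurable_pos_half_line])
  qed
  from measurable_compose[OF this 1] have "(\<lambda>(\<omega>, u). f (\<omega>, u))
      \<in> borel_measurable (P \<Otimes>\<^sub>M restrict_space lborel {0<..})"
    by simp
  then show ?thesis
    by (intro sigma_finite_measure.borel_measurable_nn_integral
        sigma_finite_measure_restrict_space)
      (auto intro: lborel.sigma_finite_measure_axioms)
qed

end

section \<open>The compensator on a single sojourn\<close>

text \<open>Open at the jump that begins the sojourn and closed at the one that ends it. This makes
  the set predictable, makes the left limit equal to \<open>state n\<close> throughout, and admits
  the closing jump but not the opening one.\<close>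

definition sojourn_window :: "'s path set \<Rightarrow> 's set \<Rightarrow> nat \<Rightarrow> real \<Rightarrow> real
    \<Rightarrow> ('s path \<times> real) set" where
  "sojourn_window A D n s t = {(\<omega>, u). \<omega> \<in> A \<and> states_in D n \<omega> \<and> s < u \<and> u \<le> t \<and>
     jump_time n \<omega> < ennreal u \<and> ennreal u \<le> jump_time (Suc n) \<omega>}"

text \<open>For paths in \<open>Omega\<close>, the event that the jump measure charges the
  window.\<close>

definition jump_event :: "'s path set \<Rightarrow> 's set \<Rightarrow> nat \<Rightarrow> real \<Rightarrow> real \<Rightarrow> 's path set" where
  "jump_event A D n s t = {\<omega> \<in> A. states_in D n \<omega> \<and>
     ennreal s < jump_time (Suc n) \<omega> \<and> jump_time (Suc n) \<omega> \<le> ennreal t}"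

text \<open>The set \<open>A\<close> is observable from time \<open>s\<close> on, and the window
  contains only later times, so the after-jump criterion applies. The right end is obtained by
  removing the times strictly after the closing jump.\<close>

lemma sets_sojourn_window:
  fixes A :: "'s::countable path set"
  assumes "A \<in> sets (filt s)" "0 \<le> s"
  shows "sojourn_window A D n s t \<in> sets predictable"
proof -
  have A: "A \<subseteq> Omega" using sets.sets_into_space[OF assms(1)] by simp
  have "Measurable.pred (filt r) (\<lambda>\<omega>. jump_time n \<omega> \<le> ennreal r \<and> (\<omega> \<in> A \<and> states_in D n \<omega>))"
    if "s \<le> r" for r
  proof -
    have [measurable]: "A \<in> sets (filt r)" using assms(1) sets_filt_mono[OF that] by auto
    have [measurable]: "Measurable.pred (filt r) (\<lambda>\<omega>. jump_time n \<omega> \<le> ennreal r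
        \<and> states_in D n \<omega>)"
      using that assms(2) by (intro pred_filt_states_in) simp
    have "Measurable.pred (filt r) (\<lambda>\<omega>. (jump_time n \<omega> \<le> ennreal r \<and> states_in D n \<omega>) \<and> \<omega> \<in> A)"
      by measurable
    then show ?thesis by (simp add: conj_ac)
  qed
  then have 1: "Measurable.pred predictable
      (\<lambda>(\<omega>, u). s < u \<and> jump_time n \<omega> < ennreal u \<and> (\<omega> \<in> A \<and> states_in D n \<omega>))"
    by (rule pred_predictable_after_jump[OF assms(2)])
  have 2: "{x \<in> space predictable. snd (x :: 's path \<times> real) \<le> t} \<in> sets predictable"
    using measurable_snd_predictable by measurable
  have "{x \<in> space predictable. case x of (\<omega>, u) \<Rightarrow> s < u \<and> jump_time n \<omega> < ennreal u \<and> (\<omega> \<in> A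
      \<and> states_in D n \<omega>)}
      \<inter> {x \<in> space predictable. snd x \<le> t}
      - {x \<in> space predictable. case x of (\<omega>, u) \<Rightarrow> jump_time (Suc n) \<omega> < ennreal u}
          \<in> sets predictable"
    using 1 pred_predictable_jump_less[of "Suc n"] unfolding pred_def
    by (intro sets.Diff sets.Int 2)
  also have "{x \<in> space predictable. case x of (\<omega>, u) \<Rightarrow> s < u \<and> jump_time n \<omega> < ennreal u \<and> (\<omega> \<in> A
      \<and> states_in D n \<omega>)}
      \<inter> {x \<in> space predictable. snd x \<le> t}
      - {x \<in> space predictable. case x of (\<omega>, u) \<Rightarrow> jump_time (Suc n) \<omega> < ennreal u}
      = sojourn_window A D n s t"
    using A assms(2) by (auto simp: sojourn_window_def not_less)
  finally show ?thesis .
qed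

lemma enn2real_jump_time_pos:
  assumes "\<omega> \<in> Omega" "1 \<le> m" "jump_time m \<omega> < \<infinity>"
  shows "0 < enn2real (jump_time m \<omega>)"
proof -
  have "0 < jump_time 1 \<omega>" using sojourn_pos[OF assms(1), of 1] by (simp add: jump_time_def)
  with jump_time_mono[OF assms(2), of \<omega>] assms(3) show ?thesis
    by (simp add: enn2real_positive_iff)
qed

lemma nn_integral_jump_measure:
  assumes "\<omega> \<in> Omega" "f \<in> borel_measurable (restrict_space borel {0<..} \<Otimes>\<^sub>M count_space UNIV)"
  shows "(\<integral>\<^sup>+ x. f x \<partial>jump_measure \<omega>) =
    (\<integral>\<^sup>+ m. f (enn2real (jump_time m \<omega>), the (state m \<omega>)) \<partial>count_space {m. 1 \<le> m
        \<and> jump_time m \<omega> < \<infinity>})"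
  unfolding jump_measure_def
proof (subst nn_integral_distr)
  show "(\<lambda>m. (enn2real (jump_time m \<omega>), the (state m \<omega>)))
    \<in> count_space {m. 1 \<le> m \<and> jump_time m \<omega> < \<infinity>}
        \<rightarrow>\<^sub>M restrict_space borel {0<..} \<Otimes>\<^sub>M count_space UNIV"
    using enn2real_jump_time_pos[OF assms(1)]
    by (simp add: measurable_count_space_eq1 space_pair_measure space_restrict_space)
qed (use assms(2) in simp_all)

text \<open>Finite jump times increase strictly, so the half-open interval between two consecutive
  ones contains no jump time but its right end.\<close>

lemma enn2real_jump_in_window_iff:
  assumes "\<omega> \<in> Omega" "jump_time m \<omega> < \<infinity>" "1 \<le> m" "0 \<le> s"
  shows "(\<omega>, enn2real (jump_time m \<omega>)) \<in> sojourn_window A D n s t \<longleftrightarrow>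
    m = Suc n \<and> \<omega> \<in> jump_event A D n s t"
proof -
  let ?u = "enn2real (jump_time m \<omega>)"
  have u: "ennreal ?u = jump_time m \<omega>" using assms(2) by simp
  have "0 < ?u" by (rule enn2real_jump_time_pos) fact+
  then have st: "s < ?u \<longleftrightarrow> ennreal s < jump_time m \<omega>" "?u \<le> t \<longleftrightarrow> jump_time m \<omega> \<le> ennreal t"
    using assms(4) ennreal_less_iff[of s ?u] ennreal_le_iff2[of ?u t] u by auto
  have "jump_time n \<omega> < jump_time m \<omega> \<and> jump_time m \<omega> \<le> jump_time (Suc n) \<omega> \<longleftrightarrow> m = Suc n"
  proof safe
    assume *: "jump_time n \<omega> < jump_time m \<omega>" "jump_time m \<omega> \<le> jump_time (Suc n) \<omega>"
    have "n < m"
      using *(1) jump_time_mono[of m n \<omega>] by (meson leD leI)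
    moreover have "\<not> Suc n < m"
    proof
      assume less: "Suc n < m"
      then have "jump_time (Suc n) \<omega> < \<infinity>"
        using le_less_trans[OF jump_time_mono assms(2)] by simp
      from jump_time_less_Suc[OF assms(1) this] jump_time_mono[of "Suc (Suc n)" m \<omega>] less *(2)
      show False by (meson Suc_leI leD order_less_le_trans)
    qed
    ultimately show "m = Suc n" by simp
  next
    assume "m = Suc n"
    then show "jump_time n \<omega> < jump_time (Suc n) \<omega>"
      using le_less_trans[OF jump_time_mono[of n m] assms(2)]
      by (intro jump_time_less_Suc[OF assms(1)]) simp
  qed
  then show ?thesis
    unfolding sojourn_window_def jump_event_def mem_Collect_eq case_prod_conv u st
    by (cases "m = Suc n") blast+
qed

context ctmdp_law begin

lemma nn_integral_policy_nu:
  assumes "\<omega> \<in> Omega" and [measurable]: "f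
      \<in> borel_measurable (restrict_space lborel {0<..} \<Otimes>\<^sub>M count_space UNIV)"
  shows "(\<integral>\<^sup>+ x. f x \<partial>policy_nu Adm q \<pi> \<omega>) =
    (\<integral>\<^sup>+ u. (\<integral>\<^sup>+ j. jump_intensity Adm q \<pi> \<omega> u j * f (u, j) \<partial>count_space UNIV)
        \<partial>restrict_space lborel {0<..})"
proof -
  have "(\<lambda>x. ((\<omega>, fst x), snd x)) \<in> restrict_space lborel {0::real<..} \<Otimes>\<^sub>M count_space (UNIV :: 's
      set)
      \<rightarrow>\<^sub>M predictable \<Otimes>\<^sub>M count_space UNIV"
    by (intro measurable_Pair measurable_compose[OF measurable_fst
          measurable_compose[OF measurable_pos_half_line measurable_Pair_predictable[OF
              assms(1)]]] measurable_snd)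
  from measurable_compose[OF this measurable_jump_intensity[OF policy]]
  have [measurable]: "(\<lambda>(u, j). jump_intensity Adm q \<pi> \<omega> u j) \<in> borel_measurable
      (restrict_space lborel {0<..} \<Otimes>\<^sub>M count_space UNIV)"
    by (simp add: split_beta')
  have "(\<integral>\<^sup>+ x. f x \<partial>policy_nu Adm q \<pi> \<omega>) =
    (\<integral>\<^sup>+ x. (case x of (u, j) \<Rightarrow> jump_intensity Adm q \<pi> \<omega> u j) * f x
      \<partial>(restrict_space lborel {0<..} \<Otimes>\<^sub>M count_space UNIV))"
    unfolding policy_nu_def by (rule nn_integral_density) measurable
  also have "\<dots> = (\<integral>\<^sup>+ u. (\<integral>\<^sup>+ j. jump_intensity Adm q \<pi> \<omega> u j * f (u, j) \<partial>count_space UNIV)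
      \<partial>restrict_space lborel {0<..})"
    by (subst sigma_finite_measure.nn_integral_fst[OF sigma_finite_measure_count_space,
        symmetric])
      (simp_all add: split_beta')
  finally show ?thesis .
qed

text \<open>The compensator identity localised to one sojourn: the left side keeps the single jump
  that ends it, the right side the intensity accumulated during it. Both sides may be
  infinite.\<close>

lemma nn_integral_jump_event:
  fixes g :: "'s \<Rightarrow> ennreal" and h :: "'s option \<Rightarrow> ennreal"
  assumes "A \<in> sets (filt s)" "0 \<le> s"
  shows "(\<integral>\<^sup>+ \<omega>. indicator (jump_event A D n s t) \<omega> * (h (state n \<omega>) * g (the (state (Suc n) \<omega>)))
      \<partial>P) =
    (\<integral>\<^sup>+ \<omega>. (\<integral>\<^sup>+ u. indicator (sojourn_window A D n s t) (\<omega>, u) * (h (state n \<omega>)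
        * intensity g \<omega> u)
        \<partial>restrict_space lborel {0<..}) \<partial>P)"
proof -
  \<comment> \<open>The test function must be predictable, so \<open>h\<close> is evaluated at the
    left limit, which agrees with \<open>state n\<close> on the window.\<close>
  define W :: "('s path \<times> real) \<times> 's \<Rightarrow> ennreal" where
    "W = (\<lambda>x. indicator (sojourn_window A D n s t) (fst x) *
      (h ((\<lambda>(\<omega>, u). xi_left u \<omega>) (fst x)) * g (snd x)))"
  have W: "W \<in> borel_measurable (predictable \<Otimes>\<^sub>M count_space UNIV)"
    unfolding W_def
  proof (intro borel_measurable_times_ennreal)
    show "(\<lambda>x. indicator (sojourn_window A D n s t) (fst x))
        \<in> borel_measurable (predictable \<Otimes>\<^sub>M count_space UNIV)"
      by (rule measurable_compose[OF measurable_fst])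
        (rule borel_measurable_indicator[OF sets_sojourn_window[OF assms]])
    show "(\<lambda>x. h ((\<lambda>(\<omega>, u). xi_left u \<omega>) (fst x)))
        \<in> borel_measurable (predictable \<Otimes>\<^sub>M count_space UNIV)"
      by (rule measurable_compose[OF measurable_fst measurable_compose[OF measurable_xi_left]])
          simp
    show "(\<lambda>x. g (snd x)) \<in> borel_measurable (predictable \<Otimes>\<^sub>M count_space UNIV)"
      by (rule measurable_compose[OF measurable_snd]) simp
  qed
  have slice: "(\<lambda>(u, j). W ((\<omega>, u), j))
      \<in> borel_measurable (restrict_space lborel {0<..} \<Otimes>\<^sub>M count_space UNIV)"
    if "\<omega> \<in> Omega" for \<omega>
  proof -
    have "(\<lambda>x. ((\<omega>, fst x), snd x)) \<in> restrict_space lborel {0::real<..} \<Otimes>\<^sub>M count_space (UNIV ::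
        's set)
        \<rightarrow>\<^sub>M predictable \<Otimes>\<^sub>M count_space UNIV"
      by (intro measurable_Pair measurable_compose[OF measurable_fst
          measurable_compose[OF measurable_pos_half_line measurable_Pair_predictable[OF that]]]
              measurable_snd)
    from measurable_compose[OF this W] show ?thesis by (simp add: split_beta')
  qed
  have window_state: "xi_left u \<omega> = state n \<omega>"
    if "\<omega> \<in> Omega" "(\<omega>, u) \<in> sojourn_window A D n s t" for \<omega> u
    using that xi_left_eq_state[of \<omega> n u] by (auto simp: sojourn_window_def)
  have "(\<integral>\<^sup>+ \<omega>. (\<integral>\<^sup>+ (u, j). W ((\<omega>, u), j) \<partial>jump_measure \<omega>) \<partial>P) =
        (\<integral>\<^sup>+ \<omega>. (\<integral>\<^sup>+ (u, j). W ((\<omega>, u), j) \<partial>policy_nu Adm q \<pi> \<omega>) \<partial>P)"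
    using projection W unfolding dual_predictable_projection_def by blast
  moreover have "(\<integral>\<^sup>+ (u, j). W ((\<omega>, u), j) \<partial>jump_measure \<omega>) =
      indicator (jump_event A D n s t) \<omega> * (h (state n \<omega>) * g (the (state (Suc n) \<omega>)))"
    if \<omega>: "\<omega> \<in> Omega" for \<omega>
  proof -
    let ?M = "{m. 1 \<le> m \<and> jump_time m \<omega> < \<infinity>}"
    have "(\<lambda>(u, j). W ((\<omega>, u), j)) \<in> borel_measurable (restrict_space borel {0<..} \<Otimes>\<^sub>M count_space
        UNIV)"
      using slice[OF \<omega>] measurable_cong_sets[OF sets_pair_measure_cong[OF
          sets_restrict_space_cong[OF sets_lborel] refl] refl] by blast
    from nn_integral_jump_measure[OF \<omega> this]
    have "(\<integral>\<^sup>+ (u, j). W ((\<omega>, u), j) \<partial>jump_measure \<omega>) =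
        (\<integral>\<^sup>+ m. W ((\<omega>, enn2real (jump_time m \<omega>)), the (state m \<omega>)) \<partial>count_space ?M)"
      by simp
    also have "\<dots> = (\<integral>\<^sup>+ m. indicator {Suc n} m * (indicator (jump_event A D n s t) \<omega> *
        (h (state n \<omega>) * g (the (state (Suc n) \<omega>)))) \<partial>count_space ?M)"
    proof (intro nn_integral_cong)
      fix m assume "m \<in> space (count_space ?M)"
      then have m: "1 \<le> m" "jump_time m \<omega> < \<infinity>" by auto
      note iff = enn2real_jump_in_window_iff[OF \<omega> m(2,1) assms(2), of A D n t]
      show "W ((\<omega>, enn2real (jump_time m \<omega>)), the (state m \<omega>)) = indicator {Suc n} m *
          (indicator (jump_event A D n s t) \<omega> * (h (state n \<omega>) * g (the (state (Suc n) \<omega>))))"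
        using iff window_state[OF \<omega>, of "enn2real (jump_time m \<omega>)"]
        by (cases "m = Suc n \<and> \<omega> \<in> jump_event A D n s t") (auto simp: W_def indicator_def)
    qed
    also have "\<dots> = indicator (jump_event A D n s t) \<omega> * (h (state n \<omega>)
        * g (the (state (Suc n) \<omega>)))"
    proof (cases "\<omega> \<in> jump_event A D n s t")
      case True
      then have "Suc n \<in> ?M" by (auto simp: jump_event_def intro: le_less_trans)
      then show ?thesis
        by (intro nn_integral_count_space'[where A="{Suc n}", THEN trans]) (auto simp:
            indicator_def)
    qed simp
    finally show ?thesis .
  qed
  moreover have "(\<integral>\<^sup>+ (u, j). W ((\<omega>, u), j) \<partial>policy_nu Adm q \<pi> \<omega>) =
    (\<integral>\<^sup>+ u. indicator (sojourn_window A D n s t) (\<omega>, u) * (h (state n \<omega>) * intensity g \<omega> u)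
        \<partial>restrict_space lborel {0<..})" if \<omega>: "\<omega> \<in> Omega" for \<omega>
  proof -
    have "(\<integral>\<^sup>+ (u, j). W ((\<omega>, u), j) \<partial>policy_nu Adm q \<pi> \<omega>) =
      (\<integral>\<^sup>+ u. (\<integral>\<^sup>+ j. jump_intensity Adm q \<pi> \<omega> u j * W ((\<omega>, u), j) \<partial>count_space UNIV)
          \<partial>restrict_space lborel {0<..})"
      by (subst nn_integral_policy_nu[OF \<omega> slice[OF \<omega>]]) simp
    also have "\<dots> = (\<integral>\<^sup>+ u. indicator (sojourn_window A D n s t) (\<omega>, u) * (h (state n \<omega>)
        * intensity g \<omega> u)
        \<partial>restrict_space lborel {0<..})"
    proof (intro nn_integral_cong)
      fix u :: real
      have "(\<integral>\<^sup>+ j. jump_intensity Adm q \<pi> \<omega> u j * W ((\<omega>, u), j) \<partial>count_space UNIV) =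
        (\<integral>\<^sup>+ j. (indicator (sojourn_window A D n s t) (\<omega>, u) * h (state n \<omega>)) *
          (g j * jump_intensity Adm q \<pi> \<omega> u j) \<partial>count_space UNIV)"
        using window_state[OF \<omega>, of u]
        by (intro nn_integral_cong) (auto simp: W_def indicator_def ac_simps)
      also have "\<dots> = indicator (sojourn_window A D n s t) (\<omega>, u) * (h (state n \<omega>)
          * intensity g \<omega> u)"
        by (simp add: nn_integral_cmult intensity_def mult.assoc)
      finally show "(\<integral>\<^sup>+ j. jump_intensity Adm q \<pi> \<omega> u j * W ((\<omega>, u), j) \<partial>count_space UNIV) =
        indicator (sojourn_window A D n s t) (\<omega>, u) * (h (state n \<omega>) * intensity g \<omega> u)" .
    qed
    finally show ?thesis .
  qed
  ultimately show ?thesis by (simp cong: nn_integral_cong_simp)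
qed

end

section \<open>Expected growth of a Lyapunov function\<close>

text \<open>
  Picard iteration instead of differentiation, since \<open>F\<close> need not be continuous.
\<close>

lemma gronwall_nn_integral:
  fixes F :: "real \<Rightarrow> ennreal" and a C :: ennreal
  assumes "0 \<le> \<rho>" "s \<le> t" "C < \<infinity>"
    and bound: "\<And>u. s \<le> u \<Longrightarrow> u \<le> t \<Longrightarrow> F u \<le> C"
    and step: "\<And>u. s \<le> u \<Longrightarrow> u \<le> t \<Longrightarrow>
      F u \<le> a + ennreal \<rho> * (\<integral>\<^sup>+ r. F r * indicator {s<..u} r \<partial>lborel)"
  shows "F t \<le> ennreal (exp (\<rho> * (t - s))) * a"
proof (cases a)
  case top
  then show ?thesis by (simp add: ennreal_mult_top)
next
  case (real a')
  obtain C' where C': "C = ennreal C'" "0 \<le> C'"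
    using assms(3) by (cases C) auto
  \<comment> \<open>An upper bound after \<open>n\<close> Picard steps from the a priori bound
    \<open>C'\<close>. The derivative of \<open>\<Phi> (Suc n)\<close> is
    \<open>\<rho> * \<Phi> n\<close>, and its value at \<open>s\<close> is \<open>a'\<close>. The
    second summand is what remains of the initial error; it tends to 0 because it is a term of the
    exponential series.\<close>
  define \<Phi> where "\<Phi> n u = a' * exp (\<rho> * (u - s)) + C' * ((\<rho> * (u - s)) ^ n / fact n)" for n u
  have \<Phi>_nonneg: "0 \<le> \<Phi> n u" if "s \<le> u" for n u
    using that real C' assms(1) by (simp add: \<Phi>_def)
  have picard: "F u \<le> ennreal (\<Phi> n u)" if "s \<le> u" "u \<le> t" for n u
    using that
  proof (induction n arbitrary: u)
    case 0
    have "F u \<le> ennreal C'" using bound[OF 0] C' by simp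
    also have "\<dots> \<le> ennreal (\<Phi> 0 u)" using real by (intro ennreal_leI) (simp add: \<Phi>_def)
    finally show ?case .
  next
    case (Suc n)
    have deriv: "(\<Phi> (Suc n) has_real_derivative \<rho> * \<Phi> n r) (at r)" for r
    proof -
      have "((\<lambda>u. \<rho> * (u - s)) has_real_derivative \<rho>) (at r)"
        by (auto intro!: derivative_eq_intros)
      from DERIV_cdivide[OF DERIV_power[OF this, of "Suc n"], of "fact (Suc n)"]
      have "((\<lambda>u. (\<rho> * (u - s)) ^ Suc n / fact (Suc n)) has_real_derivative
          (of_nat (Suc n) * (\<rho> * (\<rho> * (r - s)) ^ n)) / fact (Suc n)) (at r)"
        by simp
      also have "(of_nat (Suc n) * (\<rho> * (\<rho> * (r - s)) ^ n)) / fact (Suc n) = \<rho> * ((\<rho>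
          * (r - s)) ^ n / fact n)"
        by (simp add: divide_simps)
      finally have "((\<lambda>u. (\<rho> * (u - s)) ^ Suc n / fact (Suc n)) has_real_derivative
          \<rho> * ((\<rho> * (r - s)) ^ n / fact n)) (at r)" .
      note DERIV_cmult[OF this, of C']
      moreover have "((\<lambda>u. a' * exp (\<rho> * (u - s))) has_real_derivative a' * (exp (\<rho> * (r - s))
          * \<rho>)) (at r)"
        by (auto intro!: derivative_eq_intros)
      ultimately have "((\<lambda>u. a' * exp (\<rho> * (u - s)) + C' * ((\<rho> * (u - s)) ^ Suc n / fact (Suc n)))
          has_real_derivative a' * (exp (\<rho> * (r - s)) * \<rho>) + C' * (\<rho> * ((\<rho>
              * (r - s)) ^ n / fact n))) (at r)"
        by (rule DERIV_add[rotated])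
      then show ?thesis
        unfolding \<Phi>_def[abs_def] by (simp only: distrib_left ac_simps)
    qed
    have [measurable]: "\<Phi> n \<in> borel_measurable borel"
      unfolding \<Phi>_def[abs_def] by measurable
    have "F u \<le> a + ennreal \<rho> * (\<integral>\<^sup>+ r. F r * indicator {s<..u} r \<partial>lborel)"
      by (rule step) fact+
    also have "\<dots> \<le> a + ennreal \<rho> * (\<integral>\<^sup>+ r. ennreal (\<Phi> n r) * indicator {s..u} r \<partial>lborel)"
      using Suc by (intro add_left_mono mult_left_mono nn_integral_mono) (auto simp:
          indicator_def)
    also have "ennreal \<rho> * (\<integral>\<^sup>+ r. ennreal (\<Phi> n r) * indicator {s..u} r \<partial>lborel) =
        (\<integral>\<^sup>+ r. ennreal (\<rho> * \<Phi> n r) * indicator {s..u} r \<partial>lborel)"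
      using assms(1)
      by (subst nn_integral_cmult[symmetric], measurable)
        (auto intro!: nn_integral_cong simp: indicator_def ennreal_mult' mult.assoc)
    also have "\<dots> = ennreal (\<Phi> (Suc n) u - \<Phi> (Suc n) s)"
      using Suc.prems assms(1) \<Phi>_nonneg
      by (intro nn_integral_FTC_Icc) (auto intro: deriv[THEN DERIV_subset] simp:
          has_real_derivative_iff_has_vector_derivative[symmetric] deriv)
    also have "a + \<dots> = ennreal (\<Phi> (Suc n) u)"
    proof -
      have "a' * 1 \<le> a' * exp (\<rho> * (u - s))"
        using real Suc.prems assms(1) by (intro mult_left_mono) auto
      moreover have "0 \<le> C' * ((\<rho> * (u - s)) ^ Suc n / fact (Suc n))"
        using Suc.prems assms(1) C' by (intro mult_nonneg_nonneg divide_nonneg_nonneg) auto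
      ultimately have "a' \<le> \<Phi> (Suc n) u" unfolding \<Phi>_def by linarith
      moreover have "\<Phi> (Suc n) s = a'" by (simp add: \<Phi>_def)
      ultimately show ?thesis
        using real by (simp add: ennreal_plus[symmetric] del: ennreal_plus)
    qed
    finally show ?case .
  qed
  have "(\<lambda>n. (\<rho> * (t - s)) ^ n / fact n) \<longlonglongrightarrow> 0"
    using summable_LIMSEQ_zero[OF summable_exp[of "\<rho> * (t - s)"]]
        by (simp add: divide_inverse mult.commute)
  then have "(\<lambda>n. \<Phi> n t) \<longlonglongrightarrow> a' * exp (\<rho> * (t - s)) + C' * 0"
    unfolding \<Phi>_def by (intro tendsto_intros)
  then have "(\<lambda>n. ennreal (\<Phi> n t)) \<longlonglongrightarrow> ennreal (a' * exp (\<rho> * (t - s)))"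
    by (intro tendsto_ennrealI) simp
  then have "F t \<le> ennreal (a' * exp (\<rho> * (t - s)))"
    by (rule LIMSEQ_le_const) (use picard assms(2) in auto)
  then show ?thesis using real by (simp add: ennreal_mult' mult.commute)
qed


section \<open>Balance of entries and exits for one sojourn\<close>

definition stay_event :: "'s path set \<Rightarrow> 's set \<Rightarrow> nat \<Rightarrow> real \<Rightarrow> 's path set" where
  "stay_event A D n t = {\<omega> \<in> A. states_in D n \<omega> \<and>
     jump_time n \<omega> \<le> ennreal t \<and> ennreal t < jump_time (Suc n) \<omega>}"

definition entry_event :: "'s path set \<Rightarrow> 's set \<Rightarrow> nat \<Rightarrow> real \<Rightarrow> real \<Rightarrow> 's path set" where
  "entry_event A D n s t = {\<omega> \<in> A. states_in D n \<omega> \<and>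
     ennreal s < jump_time n \<omega> \<and> jump_time n \<omega> \<le> ennreal t}"

text \<open>A conservation law, valid for every path because the \<open>n\<close>-th sojourn occurs
  at most once: present at \<open>s\<close> or entering during \<open>(s, t]\<close> is the same as
  present at \<open>t\<close> or leaving during \<open>(s, t]\<close>.\<close>

lemma stay_event_balance:
  assumes "s \<le> t"
  shows "indicator (stay_event A D n t) \<omega> + indicator (jump_event A D n s t) \<omega> =
    (indicator (stay_event A D n s) \<omega> + indicator (entry_event A D n s t) \<omega> :: ennreal)"
proof -
  have "ennreal s \<le> ennreal t" "jump_time n \<omega> \<le> jump_time (Suc n) \<omega>"
    using assms by (auto intro: ennreal_leI jump_time_mono)
  then show ?thesis
    unfolding stay_event_def jump_event_def entry_event_def
    by (cases "\<omega> \<in> A \<and> states_in D n \<omega>"; cases "jump_time n \<omega> \<le> ennreal s";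
        cases "jump_time n \<omega> \<le> ennreal t"; cases "jump_time (Suc n) \<omega> \<le> ennreal t";
        cases "jump_time (Suc n) \<omega> \<le> ennreal s")
      (auto simp: indicator_def not_le not_less)
qed

lemma entry_event_0: "entry_event A D 0 s t = {}"
  by (auto simp: entry_event_def)

lemma entry_event_Suc: "entry_event A D (Suc n) s t = {\<omega> \<in> jump_event A D n s t. state (Suc n) \<omega>
    \<in> Some ` D}"
  by (auto simp: entry_event_def jump_event_def states_in_def le_Suc_eq)

text \<open>
  The drift inequality is written without the diagonal rate \<open>q(i|i,a)\<close>, which is minus the
  total exit rate \<open>exit_rate (\<lambda>_. 1) i a\<close>; this keeps all terms nonnegative.
\<close>

locale ctmdp_lyapunov = ctmdp_law Adm q \<pi> P
  for Adm :: "'s::countable \<Rightarrow> 'a::polish_space set" and q :: "'s \<Rightarrow> 's \<Rightarrow> 'a \<Rightarrow> real"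
    and \<pi> :: "'s path \<times> real \<Rightarrow> 'a option measure" and P :: "'s path measure" +
  fixes v :: "'s \<Rightarrow> ennreal" and \<rho> :: real
  assumes rho_nonneg: "0 \<le> \<rho>"
    and v_finite: "\<And>x. v x < \<infinity>"
    and drift: "\<And>x a. a \<in> Adm x \<Longrightarrow>
      exit_rate v x (Some a) \<le> ennreal \<rho> * v x + v x * exit_rate (\<lambda>_. 1) x (Some a)"
begin

text \<open>The value 0 at \<open>None\<close> restricts expectations to paths that have not
  exploded, so the growth estimates can be proved before non-explosion is known.\<close>

abbreviation vext :: "'s option \<Rightarrow> ennreal" where "vext \<equiv> case_option 0 v"

definition stay_value :: "'s path set \<Rightarrow> 's set \<Rightarrow> nat \<Rightarrow> real \<Rightarrow> ennreal" where
  "stay_value A D n t = (\<integral>\<^sup>+ \<omega>. indicator (stay_event A D n t) \<omega> * vext (state n \<omega>) \<partial>P)"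

lemma measurable_vext_state: "(\<lambda>\<omega>. vext (state n \<omega>)) \<in> borel_measurable P"
proof -
  have "state n \<in> P \<rightarrow>\<^sub>M count_space UNIV" by measurable
  then show ?thesis by (rule measurable_compose) simp
qed

lemma sets_events:
  assumes [measurable]: "A \<in> sets P"
  shows "stay_event A D n t \<in> sets P" "jump_event A D n s t \<in> sets P" "entry_event A D n s t
      \<in> sets P"
proof -
  have "{\<omega> \<in> space P. \<omega> \<in> A \<and> states_in D n \<omega> \<and> jump_time n \<omega> \<le> ennreal t
      \<and> ennreal t < jump_time (Suc n) \<omega>} \<in> sets P"
    "{\<omega> \<in> space P. \<omega> \<in> A \<and> states_in D n \<omega> \<and> ennreal s < jump_time (Suc n) \<omega> \<and> jump_time (Suc n) \<omega>
        \<le> ennreal t} \<in> sets P"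
    "{\<omega> \<in> space P. \<omega> \<in> A \<and> states_in D n \<omega> \<and> ennreal s < jump_time n \<omega> \<and> jump_time n \<omega>
        \<le> ennreal t} \<in> sets P"
    by measurable
  moreover have "A \<subseteq> space P" using assms by (rule sets.sets_into_space)
  then have "stay_event A D n t = {\<omega> \<in> space P. \<omega> \<in> A \<and> states_in D n \<omega> \<and> jump_time n \<omega>
      \<le> ennreal t \<and> ennreal t < jump_time (Suc n) \<omega>}"
    "jump_event A D n s t = {\<omega> \<in> space P. \<omega> \<in> A \<and> states_in D n \<omega>
        \<and> ennreal s < jump_time (Suc n) \<omega> \<and> jump_time (Suc n) \<omega> \<le> ennreal t}"
    "entry_event A D n s t = {\<omega> \<in> space P. \<omega> \<in> A \<and> states_in D n \<omega> \<and> ennreal s < jump_time n \<omega>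
        \<and> jump_time n \<omega> \<le> ennreal t}"
    unfolding stay_event_def jump_event_def entry_event_def by blast+
  ultimately show "stay_event A D n t \<in> sets P" "jump_event A D n s t \<in> sets P"
      "entry_event A D n s t \<in> sets P"
    by simp_all
qed

lemma stay_measurable_pair:
  assumes [measurable]: "A \<in> sets P"
  shows "(\<lambda>(\<omega>, u). indicator (stay_event A D n u) \<omega> * vext (state n \<omega>))
      \<in> borel_measurable (P \<Otimes>\<^sub>M lborel)"
proof -
  have 1: "{x \<in> space (P \<Otimes>\<^sub>M lborel). fst x \<in> A \<and> states_in D n (fst x) \<and> jump_time n (fst x)
      \<le> ennreal (snd x)
      \<and> ennreal (snd x) < jump_time (Suc n) (fst x)} \<in> sets (P \<Otimes>\<^sub>M lborel)" (is "?S \<in> _")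
    by measurable
  have 2: "(\<lambda>x. vext (state n (fst x))) \<in> borel_measurable (P \<Otimes>\<^sub>M lborel)"
    by (rule measurable_compose[OF measurable_fst measurable_vext_state])
  have "A \<subseteq> space P" using assms by (rule sets.sets_into_space)
  then have "indicator (stay_event A D n u) \<omega> = (indicator ?S (\<omega>, u) :: ennreal)" for \<omega> u
    by (auto simp: stay_event_def indicator_def space_pair_measure)
  then show ?thesis
    using borel_measurable_times_ennreal[OF borel_measurable_indicator[OF 1] 2]
        by (simp add: split_beta')
qed

lemma measurable_stay_value:
  assumes "A \<in> sets P"
  shows "stay_value A D n \<in> borel_measurable lborel"
proof -
  have "(\<lambda>(u, \<omega>). indicator (stay_event A D n u) \<omega> * vext (state n \<omega>))
      \<in> borel_measurable (lborel \<Otimes>\<^sub>M P)"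
    using measurable_pair_swap[OF stay_measurable_pair[OF assms]] by (simp add: split_beta')
  then show ?thesis
    unfolding stay_value_def[abs_def] by (rule borel_measurable_nn_integral)
qed

text \<open>Tonelli's theorem. The window contains the right end of the sojourn and the stay event
  the left end; for each path they differ at no more than two times in \<open>(s, t]\<close>, which
  Lebesgue measure ignores.\<close>

lemma window_integral_eq:
  assumes A: "A \<in> sets P" and "0 \<le> s"
  shows "(\<integral>\<^sup>+ \<omega>. (\<integral>\<^sup>+ u. indicator (sojourn_window A D n s t) (\<omega>, u) * vext (state n \<omega>)
      \<partial>restrict_space lborel {0<..}) \<partial>P) = (\<integral>\<^sup>+ u. stay_value A D n u * indicator {s<..t} u
          \<partial>lborel)"
proof -
  let ?f = "\<lambda>\<omega> u. indicator (stay_event A D n u) \<omega> * vext (state n \<omega>)"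
  have "(\<integral>\<^sup>+ u. indicator (sojourn_window A D n s t) (\<omega>, u) * vext (state n \<omega>)
      \<partial>restrict_space lborel {0<..}) =
      (\<integral>\<^sup>+ u. ?f \<omega> u * indicator {s<..t} u \<partial>lborel)" for \<omega>
  proof -
    have "(\<integral>\<^sup>+ u. indicator (sojourn_window A D n s t) (\<omega>, u) * vext (state n \<omega>)
        \<partial>restrict_space lborel {0<..}) =
      (\<integral>\<^sup>+ u. (indicator (sojourn_window A D n s t) (\<omega>, u) * vext (state n \<omega>))
          * indicator {0<..} u \<partial>lborel)"
      by (rule nn_integral_restrict_space) simp
    also have "\<dots> = (\<integral>\<^sup>+ u. ?f \<omega> u * indicator {s<..t} u \<partial>lborel)"
    proof (rule nn_integral_cong_AE)
      have "AE u in lborel. u \<notin> {enn2real (jump_time n \<omega>), enn2real (jump_time (Suc n) \<omega>)}"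
        by (rule AE_not_in) (auto intro!: finite_imp_null_set_lborel)
      then show "AE u in lborel. (indicator (sojourn_window A D n s t) (\<omega>, u) * vext (state n \<omega>))
          * indicator {0<..} u =
        ?f \<omega> u * indicator {s<..t} u"
      proof eventually_elim
        case (elim u)
        have "jump_time k \<omega> \<noteq> ennreal u" if "0 < u" "k = n \<or> k = Suc n" for k
          using elim that by (metis enn2real_ennreal insertCI less_imp_le)
        then have "0 < u \<Longrightarrow> jump_time n \<omega> \<noteq> ennreal u" "0 < u \<Longrightarrow> jump_time (Suc n) \<omega> \<noteq> ennreal u"
            by auto
        then show ?case
          using \<open>0 \<le> s\<close> by (auto simp: indicator_def sojourn_window_def stay_event_def
              order.order_iff_strict)
      qed
    qed
    finally show ?thesis .
  qed
  then have "(\<integral>\<^sup>+ \<omega>. (\<integral>\<^sup>+ u. indicator (sojourn_window A D n s t) (\<omega>, u) * vext (state n \<omega>)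
      \<partial>restrict_space lborel {0<..}) \<partial>P) = (\<integral>\<^sup>+ \<omega>. (\<integral>\<^sup>+ u. ?f \<omega> u * indicator {s<..t} u \<partial>lborel)
          \<partial>P)"
    by simp
  also have "\<dots> = (\<integral>\<^sup>+ u. (\<integral>\<^sup>+ \<omega>. ?f \<omega> u * indicator {s<..t} u \<partial>P) \<partial>lborel)"
  proof (rule pair_sigma_finite.Fubini'[symmetric])
    show "pair_sigma_finite P lborel"
      by (intro pair_sigma_finite.intro sigma_finite_measure_axioms
          lborel.sigma_finite_measure_axioms)
    have "(\<lambda>x. indicator {s<..t} (snd x) :: ennreal) \<in> borel_measurable (P \<Otimes>\<^sub>M lborel)"
        by measurable
    from borel_measurable_times_ennreal[OF stay_measurable_pair[OF A] this]
    show "(\<lambda>(\<omega>, u). ?f \<omega> u * indicator {s<..t} u) \<in> borel_measurable (P \<Otimes>\<^sub>M lborel)"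
      by (simp add: split_beta')
  qed
  also have "\<dots> = (\<integral>\<^sup>+ u. stay_value A D n u * indicator {s<..t} u \<partial>lborel)"
    unfolding stay_value_def
    by (intro nn_integral_cong nn_integral_multc borel_measurable_times_ennreal
        borel_measurable_indicator sets_events A measurable_vext_state)
  finally show ?thesis .
qed

end

section \<open>Gains and losses, summed over sojourns\<close>

context ctmdp_lyapunov begin

lemma sets_filt_P: "A \<in> sets (filt s) \<Longrightarrow> A \<in> sets P"
  using sets_filt_subset sets_P by blast

lemma measurable_window_value:
  assumes "A \<in> sets (filt s)" "0 \<le> s"
  shows "(\<lambda>x. indicator (sojourn_window A D n s t) x * vext ((\<lambda>(\<omega>, u). xi_left u \<omega>) x))
    \<in> borel_measurable predictable"
  by (rule borel_measurable_times_ennreal[OF borel_measurable_indicator[OF sets_sojourn_window[OF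
      assms]]])
    (rule measurable_compose[OF measurable_xi_left], simp)

lemma indicator_window_xi_left:
  assumes "\<omega> \<in> Omega"
  shows "indicator (sojourn_window A D n s t) (\<omega>, u) * vext (xi_left u \<omega>) =
    indicator (sojourn_window A D n s t) (\<omega>, u) * vext (state n \<omega>)"
  using assms xi_left_eq_state[of \<omega> n u] by (auto simp: sojourn_window_def indicator_def)

text \<open>The gain at the closing jump has intensity \<open>intensity v\<close>, which the drift
  condition splits in two. The \<open>\<rho>\<close> part integrates to the stay value. The other
  part, current value times total exit intensity, compensates the value lost at that same
  jump.\<close>

lemma entry_value_le:
  assumes A: "A \<in> sets (filt s)" and s: "0 \<le> s"
  shows "(\<integral>\<^sup>+ \<omega>. indicator (entry_event A D (Suc n) s t) \<omega> * vext (state (Suc n) \<omega>) \<partial>P) \<le>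
    ennreal \<rho> * (\<integral>\<^sup>+ u. stay_value A D n u * indicator {s<..t} u \<partial>lborel) +
    (\<integral>\<^sup>+ \<omega>. indicator (jump_event A D n s t) \<omega> * vext (state n \<omega>) \<partial>P)"
proof -
  let ?W = "sojourn_window A D n s t"
  let ?xi = "\<lambda>x :: 's path \<times> real. vext ((\<lambda>(\<omega>, u). xi_left u \<omega>) x)"
  note xi = indicator_window_xi_left
  define F1 where "F1 = (\<lambda>x. indicator ?W x * ?xi x)"
  define F2 where "F2 = (\<lambda>x. F1 x * (\<lambda>(\<omega>, u). intensity (\<lambda>_. 1) \<omega> u) x)"
  have F1: "F1 \<in> borel_measurable predictable" unfolding F1_def
      by (rule measurable_window_value[OF A s])
  have F2: "F2 \<in> borel_measurable predictable"
    unfolding F2_def by (rule borel_measurable_times_ennreal[OF F1 measurable_intensity])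
  have "(\<integral>\<^sup>+ \<omega>. indicator (entry_event A D (Suc n) s t) \<omega> * vext (state (Suc n) \<omega>) \<partial>P) \<le>
    (\<integral>\<^sup>+ \<omega>. indicator (jump_event A D n s t) \<omega> * ((\<lambda>_. 1) (state n \<omega>) * v (the (state (Suc n) \<omega>)))
        \<partial>P)"
    \<comment> \<open>Dropping the requirement that the new state lie in \<open>D\<close> only
      enlarges the gain; the truncation thus acts in the favourable direction.\<close>
    by (intro nn_integral_mono) (auto simp: entry_event_Suc indicator_def)
  also have "\<dots> = (\<integral>\<^sup>+ \<omega>. (\<integral>\<^sup>+ u. indicator ?W (\<omega>, u) * ((\<lambda>_. 1) (state n \<omega>) * intensity v \<omega> u)
        \<partial>restrict_space lborel {0<..}) \<partial>P)"
    by (rule nn_integral_jump_event[OF A s])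
  also have "\<dots> \<le> (\<integral>\<^sup>+ \<omega>. (\<integral>\<^sup>+ u. ennreal \<rho> * F1 (\<omega>, u) + F2 (\<omega>, u) \<partial>restrict_space lborel {0<..})
      \<partial>P)"
  proof (intro nn_integral_mono)
    fix \<omega> u assume "\<omega> \<in> space P" "u \<in> space (restrict_space lborel {0::real<..})"
    then have \<omega>: "\<omega> \<in> Omega" and u: "0 < u" by (auto simp: space_restrict_space)
    show "indicator ?W (\<omega>, u) * ((\<lambda>_. 1) (state n \<omega>) * intensity v \<omega> u) \<le> ennreal \<rho> * F1 (\<omega>, u)
        + F2 (\<omega>, u)"
    proof (cases "(\<omega>, u) \<in> ?W")
      case True
      then obtain x where x: "state n \<omega> = Some x"
        by (auto simp: sojourn_window_def states_in_def)
      have "xi_left u \<omega> = Some x"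
        using True xi_left_eq_state[OF \<omega>, of n u] x by (auto simp: sojourn_window_def)
      with intensity_le[OF \<omega> _ this drift] u
      have "intensity v \<omega> u \<le> ennreal \<rho> * v x + v x * intensity (\<lambda>_. 1) \<omega> u" by simp
      with True \<open>xi_left u \<omega> = Some x\<close> show ?thesis by (simp add: F1_def F2_def)
    qed simp
  qed
  also have "\<dots> = (\<integral>\<^sup>+ \<omega>. ennreal \<rho> * (\<integral>\<^sup>+ u. F1 (\<omega>, u) \<partial>restrict_space lborel {0<..}) +
      (\<integral>\<^sup>+ u. F2 (\<omega>, u) \<partial>restrict_space lborel {0<..}) \<partial>P)"
    by (intro nn_integral_cong, subst nn_integral_add, rule borel_measurable_times_ennreal[OF
        borel_measurable_const])
      (simp_all add: predictable_section[OF F1] predictable_section[OF F2]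
        nn_integral_cmult[OF predictable_section[OF F1]])
  also have "\<dots> = ennreal \<rho> * (\<integral>\<^sup>+ \<omega>. (\<integral>\<^sup>+ u. F1 (\<omega>, u) \<partial>restrict_space lborel {0<..}) \<partial>P) +
      (\<integral>\<^sup>+ \<omega>. (\<integral>\<^sup>+ u. F2 (\<omega>, u) \<partial>restrict_space lborel {0<..}) \<partial>P)"
    by (subst nn_integral_add, rule borel_measurable_times_ennreal[OF borel_measurable_const])
      (rule measurable_predictable_integral[OF F1], rule measurable_predictable_integral[OF F2],
        simp add: nn_integral_cmult[OF measurable_predictable_integral[OF F1]])
  also have "(\<integral>\<^sup>+ \<omega>. (\<integral>\<^sup>+ u. F1 (\<omega>, u) \<partial>restrict_space lborel {0<..}) \<partial>P) =
      (\<integral>\<^sup>+ \<omega>. (\<integral>\<^sup>+ u. indicator ?W (\<omega>, u) * vext (state n \<omega>) \<partial>restrict_space lborel {0<..}) \<partial>P)"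
    by (intro nn_integral_cong) (simp only: F1_def case_prod_conv xi space_P)
  also have "\<dots> = (\<integral>\<^sup>+ u. stay_value A D n u * indicator {s<..t} u \<partial>lborel)"
    by (rule window_integral_eq[OF sets_filt_P[OF A] s])
  also have "(\<integral>\<^sup>+ \<omega>. (\<integral>\<^sup>+ u. F2 (\<omega>, u) \<partial>restrict_space lborel {0<..}) \<partial>P) =
      (\<integral>\<^sup>+ \<omega>. (\<integral>\<^sup>+ u. indicator ?W (\<omega>, u) * (vext (state n \<omega>) * intensity (\<lambda>_. 1) \<omega> u)
          \<partial>restrict_space lborel {0<..}) \<partial>P)"
    by (intro nn_integral_cong) (simp only: F1_def F2_def xi space_P mult.assoc[symmetric]
        case_prod_conv)
  also have "\<dots> = (\<integral>\<^sup>+ \<omega>. indicator (jump_event A D n s t) \<omega> * (vext (state n \<omega>) * 1) \<partial>P)"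
    \<comment> \<open>The identity is used in reverse, with \<open>h = vext\<close> and
      \<open>g = 1\<close>, to turn the exit intensity back into a loss.\<close>
    by (rule nn_integral_jump_event[OF A s, symmetric])
  finally show ?thesis by simp
qed

lemma stay_value_balance:
  assumes A: "A \<in> sets P" and "s \<le> t"
  shows "stay_value A D n t + (\<integral>\<^sup>+ \<omega>. indicator (jump_event A D n s t) \<omega> * vext (state n \<omega>) \<partial>P) =
    stay_value A D n s + (\<integral>\<^sup>+ \<omega>. indicator (entry_event A D n s t) \<omega> * vext (state n \<omega>) \<partial>P)"
proof -
  have m: "(\<lambda>\<omega>. indicator E \<omega> * vext (state n \<omega>)) \<in> borel_measurable P" if "E \<in> sets P" for E
    by (intro borel_measurable_times_ennreal borel_measurable_indicator that
        measurable_vext_state)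
  note m = sets_events[OF A, THEN m]
  show ?thesis
    unfolding stay_value_def
    by (subst (1 2) nn_integral_add[symmetric])
      (simp_all add: m distrib_right[symmetric] stay_event_balance[OF assms(2)])
qed

lemma truncated_value_bounds:
  assumes "A \<in> sets P" "C < \<infinity>" "\<And>x. x \<in> D \<Longrightarrow> v x \<le> C"
  shows "(\<integral>\<^sup>+ \<omega>. indicator (jump_event A D n s t) \<omega> * vext (state n \<omega>) \<partial>P) < \<infinity>"
    and "stay_value A D n t \<le> C"
proof -
  have *: "(\<integral>\<^sup>+ \<omega>. indicator E \<omega> * vext (state n \<omega>) \<partial>P) \<le> C" if "\<And>\<omega>. \<omega> \<in> E \<Longrightarrow> states_in D n \<omega>"
      for E
  proof -
    have "(\<integral>\<^sup>+ \<omega>. indicator E \<omega> * vext (state n \<omega>) \<partial>P) \<le> (\<integral>\<^sup>+ \<omega>. C \<partial>P)"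
      using that assms(3) by (intro nn_integral_mono) (fastforce simp: indicator_def
          states_in_def)
    also have "\<dots> = C" using emeasure_space_1 by simp
    finally show ?thesis .
  qed
  show "(\<integral>\<^sup>+ \<omega>. indicator (jump_event A D n s t) \<omega> * vext (state n \<omega>) \<partial>P) < \<infinity>"
    using * assms(2) by (rule le_less_trans) (simp add: jump_event_def)
  show "stay_value A D n t \<le> C"
    unfolding stay_value_def by (rule *) (simp add: stay_event_def)
qed

text \<open>The integral form of the drift inequality for the truncated process: in the sum of the
  balances, the loss on leaving one sojourn is matched by the gain on entering the next.\<close>

lemma sum_stay_value_step:
  assumes A: "A \<in> sets (filt s)" and s: "0 \<le> s" "s \<le> t"
    and D: "C < \<infinity>" "\<And>x. x \<in> D \<Longrightarrow> v x \<le> C"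
  shows "(\<Sum>n\<le>m. stay_value A D n t) \<le> (\<Sum>n\<le>m. stay_value A D n s) +
    ennreal \<rho> * (\<integral>\<^sup>+ u. (\<Sum>n\<le>m. stay_value A D n u) * indicator {s<..t} u \<partial>lborel)"
proof -
  note AP = sets_filt_P[OF A]
  define J where "J n = (\<integral>\<^sup>+ \<omega>. indicator (jump_event A D n s t) \<omega> * vext (state n \<omega>) \<partial>P)" for n
  define B where "B n = (\<integral>\<^sup>+ \<omega>. indicator (entry_event A D n s t) \<omega> * vext (state n \<omega>) \<partial>P)" for n
  define G where "G n = (\<integral>\<^sup>+ u. stay_value A D n u * indicator {s<..t} u \<partial>lborel)" for n
  have fin: "(\<Sum>n\<le>m. J n) < \<infinity>"
    using truncated_value_bounds(1)[OF AP D] by (simp add: J_def less_top[symmetric])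
  have "B 0 = 0" by (simp add: B_def entry_event_0)
  have B: "(\<Sum>n\<le>m. B n) \<le> ennreal \<rho> * (\<Sum>n\<le>m. G n) + (\<Sum>n\<le>m. J n)"
  proof -
    \<comment> \<open>Adding the entry into sojourn \<open>Suc m\<close> lets the index shift pair
      each loss \<open>J n\<close> with the gain that follows it. Nothing enters sojourn 0, because
      \<open>jump_time 0\<close> is never greater than \<open>s\<close>.\<close>
    have "(\<Sum>n\<le>m. B n) \<le> (\<Sum>n\<le>Suc m. B n)" by simp
    also have "\<dots> = (\<Sum>n\<le>m. B (Suc n))" using \<open>B 0 = 0\<close>
        by (simp add: sum.atMost_Suc_shift del: sum.atMost_Suc)
    also have "\<dots> \<le> (\<Sum>n\<le>m. ennreal \<rho> * G n + J n)"
      unfolding B_def G_def J_def by (intro sum_mono entry_value_le A s)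
    finally show ?thesis by (simp add: sum.distrib sum_distrib_left)
  qed
  have "(\<Sum>n\<le>m. J n) + (\<Sum>n\<le>m. stay_value A D n t) = (\<Sum>n\<le>m. stay_value A D n s + B n)"
    unfolding sum.distrib[symmetric] J_def B_def
    using stay_value_balance[OF AP s(2)] by (simp add: add.commute)
  also have "\<dots> \<le> (\<Sum>n\<le>m. J n) + ((\<Sum>n\<le>m. stay_value A D n s) + ennreal \<rho> * (\<Sum>n\<le>m. G n))"
    using add_left_mono[OF B, of "\<Sum>n\<le>m. stay_value A D n s"] by (simp add: sum.distrib ac_simps)
  \<comment> \<open>The losses \<open>J\<close> cancel because \<open>v\<close> is bounded on \<open>D\<close>.\<close>
  finally have "(\<Sum>n\<le>m. stay_value A D n t) \<le> (\<Sum>n\<le>m. stay_value A D n s) + ennreal \<rho> * (\<Sum>n\<le>m. G n)"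
    using fin by (metis ennreal_add_left_cancel_le less_irrefl)
  also have "(\<Sum>n\<le>m. G n) = (\<integral>\<^sup>+ u. (\<Sum>n\<le>m. stay_value A D n u) * indicator {s<..t} u \<partial>lborel)"
    unfolding G_def sum_distrib_right
    using measurable_stay_value[OF AP] by (intro nn_integral_sum[symmetric]) simp
  finally show ?thesis .
qed

lemma sum_stay_value_le:
  assumes A: "A \<in> sets (filt s)" and s: "0 \<le> s" "s \<le> t"
    and D: "C < \<infinity>" "\<And>x. x \<in> D \<Longrightarrow> v x \<le> C"
  shows "(\<Sum>n\<le>m. stay_value A D n t) \<le> ennreal (exp (\<rho> * (t - s))) * (\<Sum>n\<le>m. stay_value A D n s)"
proof (rule gronwall_nn_integral[OF rho_nonneg s(2)])
  \<comment> \<open>The a priori bound for Gronwall's inequality comes from the truncation: at most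
    \<open>C\<close> for each of \<open>Suc m\<close> sojourns.\<close>
  show "of_nat (Suc m) * C < \<infinity>" using D(1) by (simp add: ennreal_mult_less_top of_nat_less_top)
  show "(\<Sum>n\<le>m. stay_value A D n u) \<le> of_nat (Suc m) * C" for u
    using sum_bounded_above[of "{..m}" "\<lambda>n. stay_value A D n u" C] truncated_value_bounds(2)[OF
        sets_filt_P[OF A] D]
    by simp
qed (use sum_stay_value_step[OF A s(1) _ D] in auto)

section \<open>Removing the truncation\<close>

lemma indicator_stay_event_xi:
  "indicator (stay_event A D n t) \<omega> * vext (state n \<omega>) = indicator (stay_event A D n t) \<omega>
      * vext (xi t \<omega>)"
  using xi_eq_state[of n \<omega> t] by (auto simp: indicator_def stay_event_def)

lemma sum_stay_event_le:
  "(\<Sum>n\<le>m. indicator (stay_event A D n t) \<omega>) \<le> (indicator A \<omega> :: ennreal)"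
proof -
  \<comment> \<open>The bound 1 alone would not survive the induction. The sharper one does: if jump
    \<open>Suc m\<close> comes after \<open>t\<close>, then sojourn \<open>Suc m\<close> has not
    begun at \<open>t\<close> and contributes 0.\<close>
  have "(\<Sum>n\<le>m. if jump_time n \<omega> \<le> ennreal t \<and> ennreal t < jump_time (Suc n) \<omega> then 1 else 0) \<le>
      (if ennreal t < jump_time (Suc m) \<omega> then 1 else 0 :: ennreal)" (is "(\<Sum>n\<le>m. ?g n) \<le> _")
  proof (induction m)
    case (Suc m)
    have "(\<Sum>n\<le>Suc m. ?g n) \<le> (if ennreal t < jump_time (Suc m) \<omega> then 1 else 0) + ?g (Suc m)"
      using add_right_mono[OF Suc] by simp
    also have "\<dots> \<le> (if ennreal t < jump_time (Suc (Suc m)) \<omega> then 1 else 0)"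
      using jump_time_mono[of "Suc m" "Suc (Suc m)" \<omega>] by (auto intro: less_le_trans)
    finally show ?case .
  qed simp
  then have "(\<Sum>n\<le>m. ?g n) \<le> 1" by (rule order_trans) simp
  then have "indicator A \<omega> * (\<Sum>n\<le>m. ?g n) \<le> indicator A \<omega> * 1" by (rule mult_left_mono) simp
  moreover have "(\<Sum>n\<le>m. indicator (stay_event A D n t) \<omega>) \<le> (\<Sum>n\<le>m. indicator A \<omega> * ?g n)"
    by (intro sum_mono) (auto simp: stay_event_def indicator_def)
  ultimately show ?thesis by (simp add: sum_distrib_left)
qed

lemma sum_stay_value_eq:
  assumes "A \<in> sets P"
  shows "(\<Sum>n\<le>m. stay_value A D n t) =
    (\<integral>\<^sup>+ \<omega>. (\<Sum>n\<le>m. indicator (stay_event A D n t) \<omega>) * vext (xi t \<omega>) \<partial>P)"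
proof -
  have m: "(\<lambda>\<omega>. indicator (stay_event A D n t) \<omega> * vext (state n \<omega>)) \<in> borel_measurable P" for n
    by (intro borel_measurable_times_ennreal borel_measurable_indicator sets_events assms
        measurable_vext_state)
  show ?thesis
    unfolding stay_value_def sum_distrib_right
    by (subst nn_integral_sum[symmetric]) (simp_all add: m[unfolded indicator_stay_event_xi]
        indicator_stay_event_xi)
qed

lemma expectation_xi_le:
  assumes A: "A \<in> sets (filt s)" and s: "0 \<le> s" "s \<le> t"
  shows "(\<integral>\<^sup>+ \<omega>. indicator A \<omega> * vext (xi t \<omega>) \<partial>P) \<le>
    ennreal (exp (\<rho> * (t - s))) * (\<integral>\<^sup>+ \<omega>. indicator A \<omega> * vext (xi s \<omega>) \<partial>P)"
proof -
  \<comment> \<open>One index \<open>k\<close> relaxes both truncations, the level of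
    \<open>v\<close> and the number of jumps. A path not exploded by time \<open>t\<close> has met
    finitely many states, each with finite \<open>v\<close>, so it is counted for all large
    \<open>k\<close>.\<close>
  define D where "D k = {x. v x \<le> of_nat k}" for k :: nat
  define f where "f k \<omega> = (\<Sum>n\<le>k. indicator (stay_event A (D k) n t) \<omega> * vext (state n \<omega>))" for k \<omega>
  have AP: "A \<in> sets P" by (rule sets_filt_P[OF A])
  then have A_sub: "A \<subseteq> Omega" using sets.sets_into_space by fastforce
  have f_meas: "f k \<in> borel_measurable P" for k
    unfolding f_def[abs_def]
    by (intro borel_measurable_sum borel_measurable_times_ennreal borel_measurable_indicator
        sets_events AP measurable_vext_state)
  have "indicator A \<omega> * vext (xi t \<omega>) \<le> liminf (\<lambda>k. f k \<omega>)" for \<omega>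
  proof (cases "\<omega> \<in> A \<and> xi t \<omega> \<noteq> None")
    case True
    then obtain x where "xi t \<omega> = Some x" by auto
    then obtain n where n: "jump_time n \<omega> \<le> ennreal t" "ennreal t < jump_time (Suc n) \<omega>"
        "state n \<omega> = Some x"
      using xi_eq_Some_iff[of \<omega> t x] True A_sub by auto
    have some: "\<exists>y. state l \<omega> = Some y" if "l \<le> n" for l
    proof -
      have "jump_time l \<omega> \<noteq> \<infinity>"
        using jump_time_mono[OF that, of \<omega>] n(1) by (auto simp: top_unique)
      then show ?thesis using jump_time_infinite[of \<omega> l] True A_sub by auto
    qed
    have "vext (state l \<omega>) < \<infinity>" if "l \<le> n" for l
      using some[OF that] v_finite by auto
    then have "(\<Sum>l\<le>n. vext (state l \<omega>)) < \<infinity>" by simp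
    then obtain K where K: "(\<Sum>l\<le>n. vext (state l \<omega>)) < of_nat K"
      using ennreal_Ex_less_of_nat[of "\<Sum>l\<le>n. vext (state l \<omega>)"] unfolding infinity_ennreal_def
          by blast
    have "eventually (\<lambda>k. indicator A \<omega> * vext (xi t \<omega>) \<le> f k \<omega>) sequentially"
      using eventually_ge_at_top[of "max n K"]
    proof eventually_elim
      case (elim k)
      have "vext (state l \<omega>) \<le> of_nat k" if "l \<le> n" for l
      proof -
        have "vext (state l \<omega>) \<le> (\<Sum>l\<le>n. vext (state l \<omega>))"
          using that by (intro member_le_sum) auto
        also have "\<dots> \<le> of_nat K" using K by simp
        also have "\<dots> \<le> of_nat k" using elim by simp
        finally show ?thesis .
      qed
      then have "states_in (D k) n \<omega>"
        using some by (force simp: states_in_def D_def)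
      then have "\<omega> \<in> stay_event A (D k) n t" using n True by (simp add: stay_event_def)
      then have "indicator A \<omega> * vext (xi t \<omega>) = indicator (stay_event A (D k) n t) \<omega>
          * vext (state n \<omega>)"
        using True n \<open>xi t \<omega> = Some x\<close> by simp
      also have "\<dots> \<le> f k \<omega>"
        unfolding f_def using elim by (intro member_le_sum) auto
      finally show ?case .
    qed
    then show ?thesis by (rule Liminf_bounded)
  qed (auto simp: indicator_def)
  then have "(\<integral>\<^sup>+ \<omega>. indicator A \<omega> * vext (xi t \<omega>) \<partial>P) \<le> (\<integral>\<^sup>+ \<omega>. liminf (\<lambda>k. f k \<omega>) \<partial>P)"
    by (intro nn_integral_mono)
  also have "\<dots> \<le> liminf (\<lambda>k. \<integral>\<^sup>+ \<omega>. f k \<omega> \<partial>P)"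
    by (rule nn_integral_liminf[OF f_meas])
  also have "\<dots> \<le> ennreal (exp (\<rho> * (t - s))) * (\<integral>\<^sup>+ \<omega>. indicator A \<omega> * vext (xi s \<omega>) \<partial>P)"
  proof (rule Liminf_le[OF sequentially_bot], rule always_eventually, rule allI)
    fix k
    have "(\<integral>\<^sup>+ \<omega>. f k \<omega> \<partial>P) = (\<Sum>n\<le>k. stay_value A (D k) n t)"
      unfolding f_def[abs_def] stay_value_def
      by (intro nn_integral_sum borel_measurable_times_ennreal borel_measurable_indicator
        sets_events AP measurable_vext_state)
    also have "\<dots> \<le> ennreal (exp (\<rho> * (t - s))) * (\<Sum>n\<le>k. stay_value A (D k) n s)"
      by (rule sum_stay_value_le[OF A s, of "of_nat k"]) (auto simp: D_def of_nat_less_top)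
    also have "(\<Sum>n\<le>k. stay_value A (D k) n s) \<le> (\<integral>\<^sup>+ \<omega>. indicator A \<omega> * vext (xi s \<omega>) \<partial>P)"
      unfolding sum_stay_value_eq[OF AP]
      by (intro nn_integral_mono mult_right_mono sum_stay_event_le) simp
    finally show "(\<integral>\<^sup>+ \<omega>. f k \<omega> \<partial>P) \<le> ennreal (exp (\<rho> * (t - s))) * (\<integral>\<^sup>+ \<omega>. indicator A \<omega>
        * vext (xi s \<omega>) \<partial>P)"
      by (simp add: mult_left_mono)
  qed
  finally show ?thesis .
qed

end

section \<open>Conditional expectations\<close>

lemma measurable_xi:
  assumes "0 \<le> t"
  shows "(xi t :: 's::countable path \<Rightarrow> _) \<in> filt t \<rightarrow>\<^sub>M count_space UNIV"
proof -
  let ?F = "filt t :: 's path measure"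
  have S: "xi t -` {Some j} \<inter> space ?F \<in> sets ?F" for j
  proof -
    have "(\<Union>n. {\<omega> \<in> space ?F. jump_time n \<omega> \<le> ennreal t \<and> state n \<omega> = Some j} -
      {\<omega> \<in> space ?F. jump_time (Suc n) \<omega> \<le> ennreal t}) \<in> sets ?F"
      using pred_filt_jump_state[OF assms] pred_filt_jump[OF assms] unfolding pred_def
      by (intro sets.countable_UN image_subsetI sets.Diff) auto
    also have "(\<Union>n. {\<omega> \<in> space ?F. jump_time n \<omega> \<le> ennreal t \<and> state n \<omega> = Some j} -
      {\<omega> \<in> space ?F. jump_time (Suc n) \<omega> \<le> ennreal t}) = xi t -` {Some j} \<inter> space ?F"
      by (auto simp: xi_eq_Some_iff simp flip: not_le)
    finally show ?thesis .
  qed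
  have "xi t -` {x} \<inter> space ?F \<in> sets ?F" for x
  proof (cases x)
    case None
    have "xi t -` {x} \<inter> space ?F = space ?F - (\<Union>j. xi t -` {Some j} \<inter> space ?F)"
      using None by auto
    also have "\<dots> \<in> sets ?F"
      by (intro sets.Diff sets.top sets.countable_UN image_subsetI S)
    finally show ?thesis .
  qed (use S in auto)
  then show ?thesis
    by (subst measurable_count_space_eq2_countable) (auto simp: measurable_def)
qed

text \<open>
  No measurability of \<open>f\<close> and no inclusion of \<open>F\<close> in \<open>M\<close> is assumed: if either fails, then
  \<open>nn_cond_exp M F f\<close> is \<open>0\<close> by convention.
\<close>

lemma nn_cond_exp_le:
  assumes "finite_measure M" and g: "g \<in> borel_measurable F"
    and fin: "(\<integral>\<^sup>+ x. g x \<partial>M) < \<infinity>"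
    and le: "\<And>A. A \<in> sets F \<Longrightarrow> (\<integral>\<^sup>+ x. indicator A x * f x \<partial>M) \<le> (\<integral>\<^sup>+ x. indicator A x * g x \<partial>M)"
  shows "AE x in M. nn_cond_exp M F f x \<le> g x"
proof (cases "f \<in> borel_measurable M \<and> subalgebra M F")
  case False
  then have "nn_cond_exp M F f = (\<lambda>_. 0)"
    unfolding nn_cond_exp_def by (simp only: if_False)
  then show ?thesis by simp
next
  case True
  interpret finite_measure M by fact
  interpret finite_measure_subalgebra M F by unfold_locales (use True in auto)
  let ?h = "nn_cond_exp M F f"
  have [measurable]: "?h \<in> borel_measurable F" by simp
  have hM: "?h \<in> borel_measurable M" and gM: "g \<in> borel_measurable M"
    using measurable_from_subalg[OF subalg] g by auto
  \<comment> \<open>The set where the bound fails belongs to \<open>F\<close>, so the hypothesis may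
    be tested on it. The integral of \<open>g\<close> is finite and cancels, leaving integral 0 for
    the nonnegative excess.\<close>
  define A where "A = {x \<in> space F. g x < ?h x}"
  have A: "A \<in> sets F" unfolding A_def using g by measurable
  then have AM: "A \<in> sets M" using subalg by (auto simp: subalgebra_def)
  have int: "(\<integral>\<^sup>+ x. indicator A x * ?h x \<partial>M) \<le> (\<integral>\<^sup>+ x. indicator A x * g x \<partial>M)"
    using nn_cond_exp_intg[of "indicator A" f] le[OF A] A True by simp
  have fin': "(\<integral>\<^sup>+ x. indicator A x * g x \<partial>M) < \<infinity>"
    using fin by (rule le_less_trans[rotated]) (auto intro!: nn_integral_mono simp: indicator_def)
  have "(\<integral>\<^sup>+ x. indicator A x * g x \<partial>M) + (\<integral>\<^sup>+ x. indicator A x * (?h x - g x) \<partial>M) =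
      (\<integral>\<^sup>+ x. indicator A x * ?h x \<partial>M)"
  proof (subst nn_integral_add[symmetric])
    show "(\<lambda>x. indicator A x * g x) \<in> borel_measurable M" "(\<lambda>x. indicator A x * (?h x - g x))
        \<in> borel_measurable M"
      using AM hM gM by measurable
  qed (auto intro!: nn_integral_cong simp: indicator_def A_def diff_add_cancel_ennreal
      add.commute)
  with int have "(\<integral>\<^sup>+ x. indicator A x * g x \<partial>M) + (\<integral>\<^sup>+ x. indicator A x * (?h x - g x) \<partial>M) \<le>
      (\<integral>\<^sup>+ x. indicator A x * g x \<partial>M) + 0"
    by (simp only: add_0_right)
  with fin' have "(\<integral>\<^sup>+ x. indicator A x * (?h x - g x) \<partial>M) = 0"
    unfolding ennreal_add_left_cancel_le le_zero_eq by (metis less_irrefl)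
  then have "AE x in M. indicator A x * (?h x - g x) = 0"
    using AM hM gM by (subst (asm) nn_integral_0_iff_AE) auto
  with AE_space show ?thesis
  proof eventually_elim
    case (elim x)
    then have "x \<in> space F" using subalg by (simp add: subalgebra_def)
    with elim(2) show ?case
      by (cases "x \<in> A") (auto simp: A_def not_less dest: ennreal_minus_eq_0)
  qed
qed

text \<open>The sets that agree almost everywhere with a member of \<open>filt s\<close> form a
  sigma-algebra containing both generating families. Integrals over the augmented filtration thereby
  reduce to the raw one.\<close>

lemma sets_complete_filt_cases:
  assumes "sets P = sets path_algebra" "A \<in> sets (complete_filt P s)"
  obtains B where "B \<in> sets (filt s)" "AE \<omega> in completion P. \<omega> \<in> A \<longleftrightarrow> \<omega> \<in> B"
proof -
  have sp: "space (completion P) = Omega"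
    using sets_eq_imp_space_eq[OF assms(1)] by simp
  have "sets (filt s) \<union> null_sets (completion P) \<subseteq> Pow Omega"
    using sets.space_closed[of "filt s"] sets.space_closed[of "completion P"] sp
    by (auto dest: null_setsD2)
  then have "A \<in> sigma_sets Omega (sets (filt s) \<union> null_sets (completion P))"
    using assms(2) by (simp add: complete_filt_def sets_measure_of)
  then have "\<exists>B\<in>sets (filt s). AE \<omega> in completion P. \<omega> \<in> A \<longleftrightarrow> \<omega> \<in> B"
  proof induction
    case (Basic a)
    then show ?case
    proof
      assume "a \<in> null_sets (completion P)"
      then have "AE \<omega> in completion P. \<omega> \<in> a \<longleftrightarrow> \<omega> \<in> {}" using AE_not_in by fastforce
      then show ?thesis by blast
    qed auto
  next
    case Empty
    then show ?case by (intro bexI[of _ "{}"]) auto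
  next
    case (Compl a)
    then obtain B where B: "B \<in> sets (filt s)" "AE \<omega> in completion P. \<omega> \<in> a \<longleftrightarrow> \<omega> \<in> B" by blast
    from B(2) have "AE \<omega> in completion P. \<omega> \<in> Omega - a \<longleftrightarrow> \<omega> \<in> Omega - B" by eventually_elim auto
    moreover have "Omega - B \<in> sets (filt s)" using sets.compl_sets[OF B(1)] by simp
    ultimately show ?case by blast
  next
    case (Union a)
    then have "\<forall>n. \<exists>B. B \<in> sets (filt s) \<and> (AE \<omega> in completion P. \<omega> \<in> a n \<longleftrightarrow> \<omega> \<in> B)"
      by blast
    from choice[OF this] obtain B where
      B: "\<And>n. B n \<in> sets (filt s)" "\<And>n::nat. AE \<omega> in completion P. \<omega> \<in> a n \<longleftrightarrow> \<omega> \<in> B n"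
      by blast
    from B(2) have "AE \<omega> in completion P. \<forall>n. \<omega> \<in> a n \<longleftrightarrow> \<omega> \<in> B n" by (simp add: AE_all_countable)
    then have "AE \<omega> in completion P. \<omega> \<in> (\<Union>n. a n) \<longleftrightarrow> \<omega> \<in> (\<Union>n. B n)" by eventually_elim auto
    moreover have "(\<Union>n. B n) \<in> sets (filt s)" using B(1) by auto
    ultimately show ?case by blast
  qed
  with that show thesis by blast
qed

section \<open>Non-explosion\<close>

context ctmdp_lyapunov begin

lemma measurable_xi_P:
  assumes "0 \<le> t"
  shows "xi t \<in> P \<rightarrow>\<^sub>M count_space UNIV"
proof (rule measurableI)
  fix X :: "'s option set"
  have "xi t -` X \<inter> space (filt t) \<in> sets (filt t)"
    by (rule measurable_sets[OF measurable_xi[OF assms]]) simp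
  from sets_filt_P[OF this] show "xi t -` X \<inter> space P \<in> sets P"
    by simp
qed simp

text \<open>If all jump times are at most \<open>t\<close>, then every sojourn ends in
  \<open>(0, t]\<close>. The probability of this is thus at most that of each single jump; adding
  over \<open>Suc m\<close> jumps bounds its multiple by a constant free of
  \<open>m\<close>.\<close>

lemma no_explosion:
  assumes "0 \<le> t" "L < \<infinity>"
    and rate: "\<And>x a. a \<in> Adm x \<Longrightarrow> exit_rate (\<lambda>_. 1) x (Some a) \<le> L * v x"
    and init: "(\<integral>\<^sup>+ \<omega>. vext (xi 0 \<omega>) \<partial>P) < \<infinity>"
  shows "AE \<omega> in P. ennreal t < explosion_time \<omega>"
proof -
  have Omega: "Omega \<in> sets (filt 0)" using sets.top[of "filt 0"] by simp
  have OP: "Omega \<in> sets P" using sets.top[of P] by simp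
  \<comment> \<open>\<open>L\<close> converts \<open>v\<close> into an exit intensity; the other
    factors are the length of the time interval and the growth estimate from time 0, at its largest
    value on \<open>(0, t]\<close>.\<close>
  define M where "M = L * (ennreal t * (ennreal (exp (\<rho> * t)) * (\<integral>\<^sup>+ \<omega>. vext (xi 0 \<omega>) \<partial>P)))"
  have M: "M < \<infinity>" unfolding M_def using assms(2) init by (simp add: ennreal_mult_less_top)
  define E where "E = {\<omega> \<in> space P. \<forall>n. jump_time n \<omega> \<le> ennreal t}"
  have E: "E \<in> sets P" unfolding E_def by measurable
  have jump: "emeasure P E \<le> L * (\<integral>\<^sup>+ u. stay_value Omega UNIV n u * indicator {0<..t} u \<partial>lborel)"
      for n
  proof -
    let ?J = "jump_event Omega UNIV n 0 t" and ?W = "sojourn_window Omega UNIV n 0 t"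
    define F where "F = (\<lambda>x. indicator ?W x * vext ((\<lambda>(\<omega>, u). xi_left u \<omega>) x))"
    have F: "F \<in> borel_measurable predictable"
      unfolding F_def by (rule measurable_window_value[OF Omega]) simp
    \<comment> \<open>Finite jump times exclude the state \<open>None\<close>, so
      \<open>states_in UNIV\<close> holds. The choice \<open>UNIV\<close> truncates nothing, which
      is harmless here: only upper bounds are chained and no losses are cancelled.\<close>
    have "E \<subseteq> ?J"
    proof
      fix \<omega> assume \<omega>: "\<omega> \<in> E"
      then have fin: "jump_time l \<omega> < \<infinity>" for l
        by (auto simp: E_def intro: le_less_trans)
      have "state l \<omega> \<noteq> None" for l
        using jump_time_infinite[of \<omega> l] fin[of l] \<omega> by (cases "state l \<omega>") (auto simp: E_def)
      moreover have "0 < jump_time (Suc n) \<omega>"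
        using enn2real_jump_time_pos[of \<omega> "Suc n"] fin[of "Suc n"] \<omega>
            by (auto simp: E_def zero_less_iff_neq_zero)
      ultimately show "\<omega> \<in> ?J"
        using \<omega> by (auto simp: E_def jump_event_def states_in_def image_iff)
    qed
    then have "emeasure P E \<le> emeasure P ?J" by (intro emeasure_mono sets_events OP)
    also have "\<dots> = (\<integral>\<^sup>+ \<omega>. indicator ?J \<omega> * ((\<lambda>_. 1) (state n \<omega>)
        * (\<lambda>_. 1) (the (state (Suc n) \<omega>))) \<partial>P)"
      using sets_events(2)[OF OP] by simp
    also have "\<dots> = (\<integral>\<^sup>+ \<omega>. (\<integral>\<^sup>+ u. indicator ?W (\<omega>, u) * ((\<lambda>_. 1) (state n \<omega>)
        * intensity (\<lambda>_. 1) \<omega> u)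
        \<partial>restrict_space lborel {0<..}) \<partial>P)"
      by (rule nn_integral_jump_event[OF Omega]) simp
    also have "\<dots> \<le> (\<integral>\<^sup>+ \<omega>. (\<integral>\<^sup>+ u. indicator ?W (\<omega>, u) * (L * vext (xi_left u \<omega>))
        \<partial>restrict_space lborel {0<..}) \<partial>P)"
    proof (intro nn_integral_mono)
      fix \<omega> u assume "\<omega> \<in> space P" "u \<in> space (restrict_space lborel {0::real<..})"
      then have \<omega>: "\<omega> \<in> Omega" and u: "0 < u" by (auto simp: space_restrict_space)
      show "indicator ?W (\<omega>, u) * ((\<lambda>_. 1) (state n \<omega>) * intensity (\<lambda>_. 1) \<omega> u)
          \<le> indicator ?W (\<omega>, u) * (L * vext (xi_left u \<omega>))"
      proof (cases "(\<omega>, u) \<in> ?W")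
        case True
        then obtain x where x: "xi_left u \<omega> = Some x"
          using xi_left_eq_state[OF \<omega>, of n u] by (auto simp: sojourn_window_def states_in_def)
        have "intensity (\<lambda>_. 1) \<omega> u \<le> L * v x + 0 * intensity (\<lambda>_. 1) \<omega> u"
          using u rate by (intro intensity_le[OF \<omega> _ x]) auto
        with x True show ?thesis by simp
      qed simp
    qed
    also have "\<dots> = (\<integral>\<^sup>+ \<omega>. (\<integral>\<^sup>+ u. L * F (\<omega>, u) \<partial>restrict_space lborel {0<..}) \<partial>P)"
      by (simp add: F_def ac_simps)
    also have "\<dots> = (\<integral>\<^sup>+ \<omega>. L * (\<integral>\<^sup>+ u. F (\<omega>, u) \<partial>restrict_space lborel {0<..}) \<partial>P)"
      by (intro nn_integral_cong nn_integral_cmult predictable_section[OF F]) simp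
    also have "\<dots> = L * (\<integral>\<^sup>+ \<omega>. (\<integral>\<^sup>+ u. F (\<omega>, u) \<partial>restrict_space lborel {0<..}) \<partial>P)"
      by (rule nn_integral_cmult[OF measurable_predictable_integral[OF F]])
    also have "(\<integral>\<^sup>+ \<omega>. (\<integral>\<^sup>+ u. F (\<omega>, u) \<partial>restrict_space lborel {0<..}) \<partial>P) =
      (\<integral>\<^sup>+ \<omega>. (\<integral>\<^sup>+ u. indicator ?W (\<omega>, u) * vext (state n \<omega>) \<partial>restrict_space lborel {0<..}) \<partial>P)"
      by (intro nn_integral_cong) (simp only: F_def case_prod_conv indicator_window_xi_left
          space_P)
    also have "\<dots> = (\<integral>\<^sup>+ u. stay_value Omega UNIV n u * indicator {0<..t} u \<partial>lborel)"
      by (rule window_integral_eq[OF OP]) simp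
    finally show ?thesis .
  qed
  have "of_nat (Suc m) * emeasure P E \<le> M" for m
  proof -
    have "of_nat (Suc m) * emeasure P E = (\<Sum>n\<le>m. emeasure P E)" by simp
    also have "\<dots> \<le> (\<Sum>n\<le>m. L * (\<integral>\<^sup>+ u. stay_value Omega UNIV n u * indicator {0<..t} u \<partial>lborel))"
      by (intro sum_mono jump)
    also have "\<dots> = L * (\<integral>\<^sup>+ u. (\<Sum>n\<le>m. stay_value Omega UNIV n u) * indicator {0<..t} u \<partial>lborel)"
      unfolding sum_distrib_left[symmetric] sum_distrib_right
      using measurable_stay_value[OF OP] by (subst nn_integral_sum) simp_all
    also have "\<dots> \<le> L * (\<integral>\<^sup>+ u. (ennreal (exp (\<rho> * t)) * (\<integral>\<^sup>+ \<omega>. vext (xi 0 \<omega>) \<partial>P))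
        * indicator {0<..t} u \<partial>lborel)"
    proof (intro mult_left_mono nn_integral_mono)
      fix u :: real
      have "(\<Sum>n\<le>m. stay_value Omega UNIV n u) \<le> ennreal (exp (\<rho> * t)) * (\<integral>\<^sup>+ \<omega>. vext (xi 0 \<omega>) \<partial>P)"
          if u: "0 < u" "u \<le> t"
      proof -
        have "(\<Sum>n\<le>m. stay_value Omega UNIV n u) \<le> (\<integral>\<^sup>+ \<omega>. indicator Omega \<omega> * vext (xi u \<omega>) \<partial>P)"
          unfolding sum_stay_value_eq[OF OP]
          by (intro nn_integral_mono mult_right_mono sum_stay_event_le) simp
        also have "\<dots> \<le> ennreal (exp (\<rho> * (u - 0))) * (\<integral>\<^sup>+ \<omega>. indicator Omega \<omega> * vext (xi 0 \<omega>)
            \<partial>P)"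
          using u by (intro expectation_xi_le Omega) auto
        also have "\<dots> \<le> ennreal (exp (\<rho> * t)) * (\<integral>\<^sup>+ \<omega>. vext (xi 0 \<omega>) \<partial>P)"
          using u rho_nonneg
          by (intro mult_mono ennreal_leI nn_integral_mono) (auto simp: indicator_def intro:
              mult_left_mono)
        finally show ?thesis .
      qed
      then show "(\<Sum>n\<le>m. stay_value Omega UNIV n u) * indicator {0<..t} u \<le>
          (ennreal (exp (\<rho> * t)) * (\<integral>\<^sup>+ \<omega>. vext (xi 0 \<omega>) \<partial>P)) * indicator {0<..t} u"
        by (auto simp: indicator_def)
    qed simp
    also have "\<dots> = M"
      using assms(1) by (subst nn_integral_cmult_indicator) (simp_all add: M_def ac_simps)
    finally show ?thesis .
  qed
  note bound = this
  have "emeasure P E = 0"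
  proof (rule ccontr)
    assume "emeasure P E \<noteq> 0"
    then have "0 < prob E" by (simp add: emeasure_eq_measure zero_less_measure_iff)
    moreover obtain M' where M': "M = ennreal M'" "0 \<le> M'" using M by (cases M) auto
    ultimately obtain m where m: "M' < of_nat m * prob E" using reals_Archimedean3 by blast
    also have "\<dots> \<le> of_nat (Suc m) * prob E" by (intro mult_right_mono) auto
    finally have "ennreal M' < ennreal (of_nat (Suc m) * prob E)"
      using M' by (intro ennreal_lessI) auto
    also have "\<dots> = of_nat (Suc m) * emeasure P E"
      unfolding emeasure_eq_measure by (simp only: ennreal_mult' of_nat_0_le_iff
          ennreal_of_nat_eq_real_of_nat)
    finally show False using bound[of m] M' by simp
  qed
  then have "E \<in> null_sets P" using E by auto
  then have "AE \<omega> in P. \<omega> \<notin> E" by (rule AE_not_in)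
  then show ?thesis
    using AE_space by eventually_elim (auto simp: E_def less_explosion_time_iff not_le)
qed

end

section \<open>From real rates to the Lyapunov setting, and conditioning\<close>

lemma nn_integral_count_space_has_sum:
  fixes f :: "'b \<Rightarrow> real"
  assumes "\<And>x. 0 \<le> f x" and "(f has_sum S) A"
  shows "(\<integral>\<^sup>+ x. ennreal (f x) \<partial>count_space A) = ennreal S"
proof -
  have "(\<lambda>x. norm (f x)) summable_on A"
    using assms by (auto simp: summable_on_def)
  then have "Infinite_Set_Sum.abs_summable_on f A"
    by (simp only: abs_summable_equivalent)
  then show ?thesis
    using assms by (simp add: nn_integral_conv_infsetsum infsetsum_infsum infsumI)
qed

context ctmdp_law begin

text \<open>Off the diagonal all terms are nonnegative, so their sum is what remains of
  \<open>S\<close> after removing the single diagonal term. With \<open>g = 1\<close> and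
  \<open>S = 0\<close> this gives the exit rate \<open>- q x x a\<close>.\<close>

lemma exit_rate_has_sum:
  assumes "a \<in> Adm x" and g: "\<And>j. 0 \<le> g j" and S: "((\<lambda>j. g j * q j x a) has_sum S) UNIV"
  shows "exit_rate (\<lambda>j. ennreal (g j)) x (Some a) = ennreal (S - g x * q x x a)"
    and "0 \<le> S - g x * q x x a"
proof -
  let ?h = "\<lambda>j. if j \<noteq> x then g j * q j x a else 0"
  have nonneg: "0 \<le> ?h j" for j
    using g q_nonneg[OF assms(1)] by simp
  have "((\<lambda>j. g j * q j x a) has_sum (g x * q x x a)) {x}"
    using has_sum_finite[of "{x}" "\<lambda>j. g j * q j x a"] by simp
  from has_sum_Diff[OF S this] have "((\<lambda>j. g j * q j x a) has_sum (S - g x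
      * q x x a)) (UNIV - {x})"
    by simp
  then have h: "(?h has_sum (S - g x * q x x a)) UNIV"
    by (rule has_sum_cong_neutral[THEN iffD1, rotated -1]) auto
  show "0 \<le> S - g x * q x x a"
    using has_sum_nonneg[OF h] nonneg by simp
  have "exit_rate (\<lambda>j. ennreal (g j)) x (Some a) = (\<integral>\<^sup>+ j. ennreal (?h j) \<partial>count_space UNIV)"
    unfolding exit_rate_def using g q_nonneg[OF assms(1)]
    by (intro nn_integral_cong) (auto simp: q_inf_def ennreal_mult)
  then show "exit_rate (\<lambda>j. ennreal (g j)) x (Some a) = ennreal (S - g x * q x x a)"
    using nn_integral_count_space_has_sum[OF nonneg h] by simp
qed

text \<open>One family of inequalities serves both conditionings: a set of the augmented filtration
  is almost everywhere one of \<open>filt s\<close>, and events about \<open>xi s\<close> belong to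
  \<open>filt s\<close>.\<close>

lemma nn_cond_exp_xi_le:
  assumes s: "0 \<le> s"
    and fin: "(\<integral>\<^sup>+ \<omega>. g (xi s \<omega>) \<partial>P) < \<infinity>"
    and le: "\<And>A. A \<in> sets (filt s) \<Longrightarrow>
      (\<integral>\<^sup>+ \<omega>. indicator A \<omega> * f \<omega> \<partial>P) \<le> (\<integral>\<^sup>+ \<omega>. indicator A \<omega> * g (xi s \<omega>) \<partial>P)"
  shows "AE \<omega> in completion P. nn_cond_exp (completion P) (complete_filt P s) f \<omega> \<le> g (xi s \<omega>)"
    and "AE \<omega> in completion P.
      nn_cond_exp (completion P) (vimage_algebra Omega (xi s) (count_space UNIV)) f \<omega>
          \<le> g (xi s \<omega>)"
proof -
  have finite: "finite_measure (completion P)"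
    using prob_space_completion by (rule prob_space.finite_measure)
  have fin': "(\<integral>\<^sup>+ \<omega>. g (xi s \<omega>) \<partial>completion P) < \<infinity>"
    using fin by (simp add: nn_integral_completion)
  have le': "(\<integral>\<^sup>+ \<omega>. indicator A \<omega> * f \<omega> \<partial>completion P) \<le> (\<integral>\<^sup>+ \<omega>. indicator A \<omega> * g (xi s \<omega>)
      \<partial>completion P)"
    if "B \<in> sets (filt s)" "AE \<omega> in completion P. \<omega> \<in> A \<longleftrightarrow> \<omega> \<in> B" for A B
  proof -
    have "(\<integral>\<^sup>+ \<omega>. indicator A \<omega> * h \<omega> \<partial>completion P) = (\<integral>\<^sup>+ \<omega>. indicator B \<omega> * h \<omega> \<partial>P)" for h
    proof -
      have "(\<integral>\<^sup>+ \<omega>. indicator A \<omega> * h \<omega> \<partial>completion P) = (\<integral>\<^sup>+ \<omega>. indicator B \<omega> * h \<omega>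
          \<partial>completion P)"
        using that(2) by (intro nn_integral_cong_AE) (auto simp: indicator_def elim!:
            eventually_mono)
      then show ?thesis by (simp add: nn_integral_completion)
    qed
    then show ?thesis using le[OF that(1)] by simp
  qed
  have filt_sub: "sets (filt s) \<subseteq> sets (complete_filt P s)" and sp: "space (complete_filt P s)
      = Omega"
  proof -
    have "sets (filt s) \<union> null_sets (completion P) \<subseteq> Pow Omega"
      using sets.space_closed[of "filt s"] sets.space_closed[of "completion P"]
      by (auto dest: null_setsD2)
    then show "sets (filt s) \<subseteq> sets (complete_filt P s)" "space (complete_filt P s) = Omega"
      by (auto simp: complete_filt_def sets_measure_of space_measure_of)
  qed
  show "AE \<omega> in completion P. nn_cond_exp (completion P) (complete_filt P s) f \<omega> \<le> g (xi s \<omega>)"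
  proof (rule nn_cond_exp_le[OF finite _ fin'])
    have "xi s \<in> complete_filt P s \<rightarrow>\<^sub>M count_space UNIV"
    proof (rule measurableI)
      fix X :: "'s option set"
      have "xi s -` X \<inter> space (filt s) \<in> sets (filt s)"
        by (rule measurable_sets[OF measurable_xi[OF s]]) simp
      with filt_sub show "xi s -` X \<inter> space (complete_filt P s) \<in> sets (complete_filt P s)"
        by (simp add: sp subset_iff)
    qed simp
    then show "(\<lambda>\<omega>. g (xi s \<omega>)) \<in> borel_measurable (complete_filt P s)"
      by (rule measurable_compose) simp
    fix A :: "'s path set" assume "A \<in> sets (complete_filt P s)"
    then obtain B where "B \<in> sets (filt s)" "AE \<omega> in completion P. \<omega> \<in> A \<longleftrightarrow> \<omega> \<in> B"
      by (rule sets_complete_filt_cases[OF sets_P])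
    then show "(\<integral>\<^sup>+ \<omega>. indicator A \<omega> * f \<omega> \<partial>completion P) \<le> (\<integral>\<^sup>+ \<omega>. indicator A \<omega> * g (xi s \<omega>)
        \<partial>completion P)"
      by (rule le')
  qed
  show "AE \<omega> in completion P.
      nn_cond_exp (completion P) (vimage_algebra Omega (xi s) (count_space UNIV)) f \<omega>
          \<le> g (xi s \<omega>)"
  proof (rule nn_cond_exp_le[OF finite _ fin'])
    have "xi s \<in> vimage_algebra Omega (xi s) (count_space UNIV) \<rightarrow>\<^sub>M count_space UNIV"
      by (rule measurable_vimage_algebra1) simp
    then show "(\<lambda>\<omega>. g (xi s \<omega>)) \<in> borel_measurable (vimage_algebra Omega (xi s) (count_space
        UNIV))"
      by (rule measurable_compose) simp
    fix A :: "'s path set" assume "A \<in> sets (vimage_algebra Omega (xi s) (count_space UNIV))"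
    then obtain X where "A = xi s -` X \<inter> Omega"
      by (auto simp: sets_vimage_algebra2)
    then have "A \<in> sets (filt s)"
      using measurable_sets[OF measurable_xi[OF s], of X] by simp
    then show "(\<integral>\<^sup>+ \<omega>. indicator A \<omega> * f \<omega> \<partial>completion P) \<le> (\<integral>\<^sup>+ \<omega>. indicator A \<omega> * g (xi s \<omega>)
        \<partial>completion P)"
      by (rule le') simp
  qed
qed

end

theorem theorem3p1:
  fixes Adm :: "'s::countable \<Rightarrow> 'a::polish_space set"
    and q :: "'s \<Rightarrow> 's \<Rightarrow> 'a \<Rightarrow> real"
    and w :: "'s \<Rightarrow> real"
    and w_inf :: ennreal
    and \<rho>1 b1 L s t :: real
    and i :: 's
    and \<pi> :: "'s path \<times> real \<Rightarrow> 'a option measure"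
    and P :: "'s path measure"
  assumes "ctmdp Adm q"
    and "\<And>i. 1 \<le> w i"
    and "0 < \<rho>1" and "0 \<le> b1" and "0 < L"
    and "\<And>i a. a \<in> Adm i \<Longrightarrow>
           (\<lambda>j. w j * q j i a) summable_on UNIV \<and>
           (\<Sum>\<^sub>\<infinity>j. w j * q j i a) \<le> \<rho>1 * w i + b1"
    and "\<And>i. qstar Adm q i \<le> L * w i"
    and "\<pi> \<in> policies Adm"
    and "is_policy_law Adm q \<pi> (return_pmf i) P"
    and "0 \<le> s" and "s < t"
  shows "(\<forall>m. AE \<omega> in completion P.
            nn_cond_exp (completion P) (complete_filt P s)
              (\<lambda>\<omega>. ext_weight w_inf w (xi t \<omega>) * indicator {\<omega>. ennreal t < jump_time (Suc m) \<omega>} \<omega>) \<omega>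
            \<le> ennreal (exp (\<rho>1 * (t - s)) + 1) * ext_weight w_inf w (xi s \<omega>)
              + ennreal (b1 / \<rho>1 * (exp (\<rho>1 * (t - s)) - 1)))
       \<and> (AE \<omega> in completion P.
            nn_cond_exp (completion P) (vimage_algebra Omega (xi s) (count_space UNIV))
              (\<lambda>\<omega>. ext_weight w_inf w (xi t \<omega>)) \<omega>
            \<le> ennreal (exp (\<rho>1 * (t - s)) + 1) * ext_weight w_inf w (xi s \<omega>)
              + ennreal (b1 / \<rho>1 * (exp (\<rho>1 * (t - s)) - 1)))"
proof -
  note w_ge = assms(2)
  define \<beta> where "\<beta> = b1 / \<rho>1"
  \<comment> \<open>The equation \<open>\<rho>1 * \<beta> = b1\<close> is what absorbs the constant:
    \<open>\<rho>1 * w + b1\<close> becomes \<open>\<rho>1 * (w + \<beta>)\<close>.\<close>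
  have \<beta>: "0 \<le> \<beta>" "\<rho>1 * \<beta> = b1" using assms(3,4) by (auto simp: \<beta>_def)
  define v where "v x = ennreal (w x + \<beta>)" for x
  have v_nonneg: "0 \<le> w x + \<beta>" and w_nonneg: "0 \<le> w x" for x
    using w_ge[of x] \<beta> by linarith+
  have v: "v x = ennreal (w x) + ennreal \<beta>" for x
    using w_nonneg \<beta> by (simp add: v_def)
  interpret ctmdp Adm q by fact
  have law: "prob_space P" "sets P = sets path_algebra" "measure P {\<omega>\<in>Omega. xi 0 \<omega> = Some i} = 1"
      "dual_predictable_projection P jump_measure (policy_nu Adm q \<pi>)"
    using assms(9) by (auto simp: is_policy_law_def)
  interpret ctmdp_law Adm q \<pi> P
    by (intro ctmdp_law.intro ctmdp_law_axioms.intro assms(1,8) law)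
  have exit_1: "exit_rate (\<lambda>_. 1) x (Some a) = ennreal (- q x x a)" "q x x a \<le> 0" if "a \<in> Adm x"
      for x a
    using exit_rate_has_sum[OF that, of "\<lambda>_. 1" 0] q_conservative[OF that] by simp_all
  have drift: "exit_rate v x (Some a) \<le> ennreal \<rho>1 * v x + v x * exit_rate (\<lambda>_. 1) x (Some a)"
    if a: "a \<in> Adm x" for x a
  proof -
    let ?S = "\<Sum>\<^sub>\<infinity>j. w j * q j x a"
    have "((\<lambda>j. w j * q j x a) has_sum ?S) UNIV"
      using assms(6)[OF a] by (simp add: has_sum_infsum)
    from has_sum_add[OF this has_sum_cmult_right[OF q_conservative[OF a], of \<beta>]]
    have "((\<lambda>j. (w j + \<beta>) * q j x a) has_sum ?S) UNIV" by (simp add: distrib_right)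
    from exit_rate_has_sum(1)[OF a v_nonneg this]
    have "exit_rate v x (Some a) = ennreal (?S - (w x + \<beta>) * q x x a)"
      by (simp add: v_def[abs_def])
    also have "\<dots> \<le> ennreal (\<rho>1 * (w x + \<beta>) + (w x + \<beta>) * (- q x x a))"
      using assms(6)[OF a] \<beta>(2) by (intro ennreal_leI) (simp add: distrib_left)
    also have "\<dots> = ennreal (\<rho>1 * (w x + \<beta>)) + ennreal ((w x + \<beta>) * (- q x x a))"
      using exit_1(2)[OF a] v_nonneg[of x] assms(3)
          by (intro ennreal_plus mult_nonneg_nonneg) auto
    also have "\<dots> = ennreal \<rho>1 * v x + v x * exit_rate (\<lambda>_. 1) x (Some a)"
      using exit_1[OF a] v_nonneg[of x] assms(3)
          by (simp only: v_def ennreal_mult' ennreal_mult'')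
    finally show ?thesis .
  qed
  interpret ctmdp_lyapunov Adm q \<pi> P v \<rho>1
    by (intro ctmdp_lyapunov.intro ctmdp_lyapunov_axioms.intro ctmdp_law_axioms drift)
      (use assms(3) in \<open>simp_all add: v_def\<close>)
  have rate: "exit_rate (\<lambda>_. 1) x (Some a) \<le> ennreal L * v x" if a: "a \<in> Adm x" for x a
  proof -
    have "- q x x a \<le> qstar Adm q x"
      unfolding qstar_def using exit_1(2)[OF a] cSUP_upper[OF a q_stable[of x]] by simp
    also have "\<dots> \<le> L * (w x + \<beta>)"
      using assms(5) assms(7)[of x] \<beta>(1) by (simp add: distrib_left add_increasing2)
    finally have "ennreal (- q x x a) \<le> ennreal (L * (w x + \<beta>))" by (rule ennreal_leI)
    also have "\<dots> = ennreal L * v x" using assms(5) by (simp add: v_def ennreal_mult')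
    finally show ?thesis using exit_1[OF a] by simp
  qed
  \<comment> \<open>The initial distribution enters here: the path starts almost surely at
    \<open>i\<close>, where \<open>v\<close> is finite.\<close>
  have init: "(\<integral>\<^sup>+ \<omega>. vext (xi 0 \<omega>) \<partial>P) < \<infinity>"
  proof -
    have "AE \<omega> in P. \<omega> \<in> {\<omega>\<in>Omega. xi 0 \<omega> = Some i}"
      using law(3) by (intro AE_prob_1)
    then have "(\<integral>\<^sup>+ \<omega>. vext (xi 0 \<omega>) \<partial>P) \<le> (\<integral>\<^sup>+ \<omega>. v i \<partial>P)"
      by (intro nn_integral_mono_AE, eventually_elim) simp
    also have "\<dots> < \<infinity>" using emeasure_space_1 v_finite[of i] by simp
    finally show ?thesis .
  qed
  \<comment> \<open>At each fixed time the value \<open>w_inf\<close> now matters only on a null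
    set, so \<open>vext\<close> may be exchanged for \<open>ext_weight w_inf w\<close> plus
    \<open>\<beta>\<close>.\<close>
  have no_expl: "AE \<omega> in P. xi u \<omega> \<noteq> None" if "0 \<le> u" for u
  proof -
    have "AE \<omega> in P. ennreal u < explosion_time \<omega>"
      by (rule no_explosion[OF that _ rate init]) simp_all
    with AE_space show ?thesis
    proof eventually_elim
      case (elim \<omega>)
      from ex_jump_interval[OF elim(2)] obtain n where
        n: "jump_time n \<omega> \<le> ennreal u" "ennreal u < jump_time (Suc n) \<omega>" .
      then have "jump_time n \<omega> < \<infinity>" by (auto intro: le_less_trans)
      then show ?case
        using xi_eq_state[OF n] jump_time_infinite[of \<omega> n] elim(1) by (cases "state n \<omega>") auto
    qed
  qed
  let ?w = "ext_weight w_inf w"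
  have vext: "vext x = ?w x + ennreal \<beta>" if "x \<noteq> None" for x
    using that by (auto simp: ext_weight_def v)
  have w_meas: "(\<lambda>\<omega>. ?w (xi u \<omega>)) \<in> borel_measurable P" if "0 \<le> u" for u
    by (rule measurable_compose[OF measurable_xi_P[OF that]]) simp
  have split: "(\<integral>\<^sup>+ \<omega>. indicator A \<omega> * vext (xi u \<omega>) \<partial>P) =
      (\<integral>\<^sup>+ \<omega>. indicator A \<omega> * ?w (xi u \<omega>) \<partial>P) + ennreal \<beta> * emeasure P A" if "A \<in> sets P" "0 \<le> u"
          for A u
  proof -
    have "(\<integral>\<^sup>+ \<omega>. indicator A \<omega> * vext (xi u \<omega>) \<partial>P) =
      (\<integral>\<^sup>+ \<omega>. indicator A \<omega> * ?w (xi u \<omega>) + ennreal \<beta> * indicator A \<omega> \<partial>P)"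
      using no_expl[OF that(2)]
      by (intro nn_integral_cong_AE, eventually_elim) (simp add: vext indicator_def)
    then show ?thesis
      using that(1) w_meas[OF that(2)] by (simp add: nn_integral_add nn_integral_cmult)
  qed
  define e where "e = exp (\<rho>1 * (t - s))"
  have e: "1 \<le> e" using assms(3,11) by (simp add: e_def)
  define g where "g x = ennreal (e + 1) * ?w x + ennreal (\<beta> * (e - 1))" for x
  have bound: "(\<integral>\<^sup>+ \<omega>. indicator A \<omega> * ?w (xi t \<omega>) \<partial>P) \<le> (\<integral>\<^sup>+ \<omega>. indicator A \<omega> * g (xi s \<omega>) \<partial>P)"
    if A: "A \<in> sets (filt s)" for A
  proof -
    note AP = sets_filt_P[OF A]
    have t: "0 \<le> t" using assms(10,11) by simp
    let ?X = "\<lambda>u. \<integral>\<^sup>+ \<omega>. indicator A \<omega> * ?w (xi u \<omega>) \<partial>P" and ?p = "emeasure P A"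
    have "?X t + ennreal \<beta> * ?p \<le> ennreal e * (?X s + ennreal \<beta> * ?p)"
      using expectation_xi_le[OF A assms(10), of t] assms(11) split[OF AP t] split[OF AP
          assms(10)]
      by (simp add: e_def)
    also have "\<dots> = ennreal e * ?X s + (ennreal e * ennreal \<beta>) * ?p"
      by (simp add: distrib_left mult.assoc)
    \<comment> \<open>The summand \<open>\<beta>\<close> cancels against the left side, where it is
      multiplied by a probability and so finite. What is left, \<open>\<beta> * (e - 1)\<close>, is
      the constant of the theorem.\<close>
    also have "ennreal e * ennreal \<beta> = ennreal (\<beta> * (e - 1)) + ennreal \<beta>"
    proof -
      have "ennreal e * ennreal \<beta> = ennreal (e * \<beta>)" using e by (simp add: ennreal_mult')
      also have "e * \<beta> = \<beta> * (e - 1) + \<beta>" by (simp add: algebra_simps)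
      also have "ennreal \<dots> = ennreal (\<beta> * (e - 1)) + ennreal \<beta>" using e \<beta>(1)
          by (intro ennreal_plus) auto
      finally show ?thesis .
    qed
    finally have "ennreal \<beta> * ?p + ?X t \<le> ennreal \<beta> * ?p + (ennreal e * ?X s + ennreal (\<beta>
        * (e - 1)) * ?p)"
      by (simp only: distrib_right add.assoc add.commute add.left_commute)
    moreover have "ennreal \<beta> * ?p < \<infinity>" by (simp add: ennreal_mult_less_top emeasure_eq_measure)
    ultimately have "?X t \<le> ennreal e * ?X s + ennreal (\<beta> * (e - 1)) * ?p"
      unfolding ennreal_add_left_cancel_le by (metis less_irrefl)
    \<comment> \<open>The argument yields the coefficient \<open>e\<close>; the stated
      \<open>e + 1\<close> follows by monotonicity.\<close>
    also have "\<dots> \<le> ennreal (e + 1) * ?X s + ennreal (\<beta> * (e - 1)) * ?p"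
      by (intro add_right_mono mult_right_mono ennreal_leI) auto
    also have "\<dots> = (\<integral>\<^sup>+ \<omega>. ennreal (e + 1) * (indicator A \<omega> * ?w (xi s \<omega>)) + ennreal (\<beta> * (e - 1))
        * indicator A \<omega> \<partial>P)"
      using AP w_meas[OF assms(10)] by (simp add: nn_integral_add nn_integral_cmult)
    also have "\<dots> = (\<integral>\<^sup>+ \<omega>. indicator A \<omega> * g (xi s \<omega>) \<partial>P)"
      by (intro nn_integral_cong) (simp add: g_def distrib_left ac_simps)
    finally show ?thesis .
  qed
  \<comment> \<open>The integrability required for conditioning comes from the growth estimate
    itself, applied between times 0 and \<open>s\<close>, together with
    \<open>w \<le> v\<close>.\<close>
  have fin: "(\<integral>\<^sup>+ \<omega>. g (xi s \<omega>) \<partial>P) < \<infinity>"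
  proof -
    have Omega: "Omega \<in> sets (filt 0)" using sets.top[of "filt 0"] by simp
    have "(\<integral>\<^sup>+ \<omega>. ?w (xi s \<omega>) \<partial>P) \<le> (\<integral>\<^sup>+ \<omega>. indicator Omega \<omega> * vext (xi s \<omega>) \<partial>P)"
    proof (rule nn_integral_mono_AE)
      show "AE \<omega> in P. ?w (xi s \<omega>) \<le> indicator Omega \<omega> * vext (xi s \<omega>)"
        using AE_space no_expl[OF assms(10)] by eventually_elim (auto simp: vext)
    qed
    also have "\<dots> \<le> ennreal (exp (\<rho>1 * (s - 0))) * (\<integral>\<^sup>+ \<omega>. indicator Omega \<omega> * vext (xi 0 \<omega>) \<partial>P)"
      by (rule expectation_xi_le[OF Omega]) (use assms(10) in auto)
    also have "(\<integral>\<^sup>+ \<omega>. indicator Omega \<omega> * vext (xi 0 \<omega>) \<partial>P) = (\<integral>\<^sup>+ \<omega>. vext (xi 0 \<omega>) \<partial>P)"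
      by (intro nn_integral_cong) simp
    also have "ennreal (exp (\<rho>1 * (s - 0))) * \<dots> < \<infinity>"
      using init by (simp add: ennreal_mult_less_top)
    finally have "(\<integral>\<^sup>+ \<omega>. ?w (xi s \<omega>) \<partial>P) < \<infinity>" .
    then show ?thesis
      using w_meas[OF assms(10)] emeasure_space_1
      by (simp add: g_def nn_integral_add nn_integral_cmult ennreal_mult_less_top)
  qed
  have "AE \<omega> in completion P. nn_cond_exp (completion P) (complete_filt P s)
      (\<lambda>\<omega>. ?w (xi t \<omega>) * indicator {\<omega>. ennreal t < jump_time (Suc m) \<omega>} \<omega>) \<omega> \<le> g (xi s \<omega>)" for m
  proof (rule nn_cond_exp_xi_le(1)[OF assms(10) fin])
    fix A :: "'s path set" assume "A \<in> sets (filt s)"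
    have "(\<integral>\<^sup>+ \<omega>. indicator A \<omega> * (?w (xi t \<omega>) * indicator {\<omega>. ennreal t < jump_time (Suc m) \<omega>} \<omega>)
        \<partial>P) \<le>
        (\<integral>\<^sup>+ \<omega>. indicator A \<omega> * ?w (xi t \<omega>) \<partial>P)"
      \<comment> \<open>Restricting to paths with fewer than \<open>Suc m\<close> jumps by time
        \<open>t\<close> only lowers the integral, so the bound for the full weight suffices for
        every \<open>m\<close>.\<close>
      by (intro nn_integral_mono) (auto simp: indicator_def)
    also have "\<dots> \<le> (\<integral>\<^sup>+ \<omega>. indicator A \<omega> * g (xi s \<omega>) \<partial>P)"
      by (rule bound) fact
    finally show "(\<integral>\<^sup>+ \<omega>. indicator A \<omega> * (?w (xi t \<omega>)
        * indicator {\<omega>. ennreal t < jump_time (Suc m) \<omega>} \<omega>) \<partial>P) \<le>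
        (\<integral>\<^sup>+ \<omega>. indicator A \<omega> * g (xi s \<omega>) \<partial>P)" .
  qed
  moreover have "AE \<omega> in completion P.
      nn_cond_exp (completion P) (vimage_algebra Omega (xi s) (count_space UNIV)) (\<lambda>\<omega>. ?w (xi t
          \<omega>)) \<omega> \<le> g (xi s \<omega>)"
    by (rule nn_cond_exp_xi_le(2)[OF assms(10) fin bound])
  ultimately show ?thesis
    unfolding g_def e_def \<beta>_def by (intro conjI allI)
qed

end
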